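(* Let $R=\mathbb{C}[x,y]$ and let $I\subset J\subset R$ be ideals with $\dim_{\mathbb{C}}R/I=n+1$ and $\dim_{\mathbb{C}}R/J=n$, so that $(I,J)$ is a closed point of the nested Hilbert scheme $S^{[n,n+1]}$ of $S=\mathbb{A}^2_{\mathbb{C}}$. Let $\iota:I\hookrightarrow J$ be the inclusion and let $\pi:R/I\to R/J$ be the natural quotient map. Then there is an isomorphism $$T_{(I,J)}S^{[n,n+1]}\;\cong\;\ker\left(\operatorname{Hom}_R(I,R/I)\oplus\operatorname{Hom}_R(J,R/J)\xrightarrow{\ \delta\ }\operatorname{Hom}_R(I,R/J)\right),$$ where $\delta(\alpha,\beta)=\pi\circ\alpha-\beta\circ\iota$.
   Context: All schemes are over $\mathbb{C}$, $S=\mathbb{A}^2_{\mathbb{C}}=\operatorname{Spec}R$ with $R=\mathbb{C}[x,y]$. $S^{[n]}=\operatorname{Hilb}^n(S)$ is the Hilbert scheme of $n$ points: it represents the functor sending a scheme $B$ to the set of closed subschemes of $S\times B$ that are finite and flat of degree $n$ over $B$; its closed points are ideals of $R$ of colength $n$. The nested Hilbert scheme $S^{[n,n+1]}\subset S^{[n+1]}\times S^{[n]}$ is the closed incidence subscheme of pairs $(Z,Y)$ with $Y\subset Z$ (equivalently, on $B$-valued points, pairs of flat families $\mathcal{Z},\mathcal{Y}\subset S\times B$ of degrees $n+1$ and $n$ with $\mathcal{Y}\subset\mathcal{Z}$). Its closed points are pairs of ideals $I\subset J\subset R$ with $\dim_{\mathbb{C}} R/I=n+1$, $\dim_{\mathbb{C}}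 R/J=n$; $I$ is the ideal of the larger subscheme $Z$, and $J$ the ideal of the smaller subscheme $Y$. $T_mM$ denotes the Zariski tangent space of a scheme $M$ at a closed point $m$, equivalently the set of morphisms $\operatorname{Spec}\mathbb{C}[\varepsilon]/(\varepsilon^2)\to M$ sending the closed point to $m$; the isomorphism is one of $\mathbb{C}$-vector spaces. *)

theory Defs
  imports "HOL-Algebra.Algebra" "HOL-Algebra.Algebraic_Closure_Type"
begin

text \<open>
  Rings are types of class \<open>comm_ring_1\<close>; ideals, quotients, modules etc. are those of HOL-Algebra,
  applied to the ring record of the type.
  \<open>'b poly poly\<close> is the ring \<open>B[x,y]\<close>, the coordinate ring of the affine plane over \<open>Spec B\<close>.
\<close>

abbreviation rng :: "'a::comm_ring_1 ring"
  where "rng \<equiv> ring_of_type_algebra"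

abbreviation const2 :: "'b::comm_ring_1 \<Rightarrow> 'b poly poly"
  where "const2 b \<equiv> [:[:b:]:]"


section \<open>Modules\<close>

text \<open>
  In module records that do not come from a ring, the fields \<open>mult\<close> and \<open>one\<close> carry no meaning and are
  left undefined.
\<close>

definition ideal_module :: "'a::comm_ring_1 set \<Rightarrow> ('a, 'a) module"
  where "ideal_module I =
    \<lparr>carrier = I, monoid.mult = (*), one = undefined, ring.zero = 0, add = (+), module.smult = (*)\<rparr>"

text \<open>\<open>A/I\<close> as a module over \<open>'r\<close>, which acts through \<open>h :: 'r \<Rightarrow> 'a\<close>.\<close>

definition quot_module :: "('r \<Rightarrow> 'a) \<Rightarrow> 'a::comm_ring_1 set \<Rightarrow> ('r, 'a set) module"
  where "quot_module h I =
    \<lparr>carrier = carrier (rng Quot I), monoid.mult = monoid.mult (rng Quot I),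
     one = one (rng Quot I), ring.zero = ring.zero (rng Quot I), add = add (rng Quot I),
     module.smult = (\<lambda>r u. (I +>\<^bsub>rng\<^esub> h r) \<otimes>\<^bsub>rng Quot I\<^esub> u)\<rparr>"

definition module_hom_set ::
    "('r, 's) ring_scheme \<Rightarrow> ('r, 'a, 'm) module_scheme \<Rightarrow> ('r, 'b, 'n) module_scheme \<Rightarrow> ('a \<Rightarrow> 'b) set"
  where "module_hom_set K M N =
    {f \<in> carrier M \<rightarrow>\<^sub>E carrier N.
       (\<forall>x\<in>carrier M. \<forall>y\<in>carrier M. f (x \<oplus>\<^bsub>M\<^esub> y) = f x \<oplus>\<^bsub>N\<^esub> f y) \<and>
       (\<forall>r\<in>carrier K. \<forall>x\<in>carrier M. f (r \<odot>\<^bsub>M\<^esub> x) = r \<odot>\<^bsub>N\<^esub> f x)}"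

definition Hom_module ::
    "('r, 's) ring_scheme \<Rightarrow> ('r, 'a, 'm) module_scheme \<Rightarrow> ('r, 'b, 'n) module_scheme
      \<Rightarrow> ('r, 'a \<Rightarrow> 'b) module"
  where "Hom_module K M N =
    \<lparr>carrier = module_hom_set K M N, monoid.mult = undefined, one = undefined,
     ring.zero = (\<lambda>x\<in>carrier M. \<zero>\<^bsub>N\<^esub>),
     add = (\<lambda>f g. \<lambda>x\<in>carrier M. f x \<oplus>\<^bsub>N\<^esub> g x),
     module.smult = (\<lambda>r f. \<lambda>x\<in>carrier M. r \<odot>\<^bsub>N\<^esub> f x)\<rparr>"

definition direct_sum_module ::
    "('r, 'a, 'm) module_scheme \<Rightarrow> ('r, 'b, 'n) module_scheme \<Rightarrow> ('r, 'a \<times> 'b) module"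
  where "direct_sum_module M N =
    \<lparr>carrier = carrier M \<times> carrier N, monoid.mult = undefined, one = undefined,
     ring.zero = (\<zero>\<^bsub>M\<^esub>, \<zero>\<^bsub>N\<^esub>),
     add = (\<lambda>(x, y) (x', y'). (x \<oplus>\<^bsub>M\<^esub> x', y \<oplus>\<^bsub>N\<^esub> y')),
     module.smult = (\<lambda>r (x, y). (r \<odot>\<^bsub>M\<^esub> x, r \<odot>\<^bsub>N\<^esub> y))\<rparr>"

definition kernel_module ::
    "('r, 'a) module \<Rightarrow> ('r, 'b) module \<Rightarrow> ('a \<Rightarrow> 'b) \<Rightarrow> ('r, 'a) module"
  where "kernel_module M N f = M\<lparr>carrier := a_kernel M N f\<rparr>"

definition restrict_scalars :: "('k \<Rightarrow> 'r) \<Rightarrow> ('r, 'a) module \<Rightarrow> ('k, 'a) module"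
  where "restrict_scalars h M =
    \<lparr>carrier = carrier M, monoid.mult = monoid.mult M, one = one M, ring.zero = ring.zero M, add = add M,
     module.smult = (\<lambda>c. module.smult M (h c))\<rparr>"

definition modules_isomorphic ::
    "('r, 's) ring_scheme \<Rightarrow> ('r, 'a, 'm) module_scheme \<Rightarrow> ('r, 'b, 'n) module_scheme \<Rightarrow> bool"
  where "modules_isomorphic K M N \<longleftrightarrow>
    Module.module K M \<and> Module.module K N \<and>
    (\<exists>f\<in>module_hom_set K M N. bij_betw f (carrier M) (carrier N))"


section \<open>Flatness\<close>

text \<open>
  \<open>N \<otimes> M\<close> is the free abelian group on \<open>N \<times> M\<close> modulo the following subgroup.
\<close>

definition tensor_null ::
    "('r, 's) ring_scheme \<Rightarrow> ('r, 'a, 'm) module_scheme \<Rightarrow> ('r, 'b, 'n) module_scheme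
      \<Rightarrow> ('a \<times> 'b \<Rightarrow>\<^sub>0 int) set"
  where "tensor_null K N M =
    generate (free_Abelian_group (carrier N \<times> carrier M))
      ({frag_of (x \<oplus>\<^bsub>N\<^esub> x', m) - frag_of (x, m) - frag_of (x', m) | x x' m.
          x \<in> carrier N \<and> x' \<in> carrier N \<and> m \<in> carrier M} \<union>
       {frag_of (x, m \<oplus>\<^bsub>M\<^esub> m') - frag_of (x, m) - frag_of (x, m') | x m m'.
          x \<in> carrier N \<and> m \<in> carrier M \<and> m' \<in> carrier M} \<union>
       {frag_of (r \<odot>\<^bsub>N\<^esub> x, m) - frag_of (x, r \<odot>\<^bsub>M\<^esub> m) | r x m.
          r \<in> carrier K \<and> x \<in> carrier N \<and> m \<in> carrier M})"

text \<open>
  \<open>M\<close> is flat over \<open>B\<close> if \<open>\<aa> \<otimes> M \<rightarrow> B \<otimes> M\<close> is injective for every ideal \<open>\<aa>\<close> of \<open>B\<close>: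
  a formal sum of pairs from \<open>\<aa> \<times> M\<close> that vanishes in \<open>B \<otimes> M\<close> already vanishes in \<open>\<aa> \<otimes> M\<close>.
\<close>

definition flat_module :: "('b::comm_ring_1, 'm) module \<Rightarrow> bool"
  where "flat_module M \<longleftrightarrow>
    (\<forall>\<aa>. ideal \<aa> (rng :: 'b ring) \<longrightarrow>
      carrier (free_Abelian_group (\<aa> \<times> carrier M)) \<inter> tensor_null rng (ideal_module (UNIV :: 'b set)) M
        \<subseteq> tensor_null rng (ideal_module \<aa>) M)"


section \<open>The functor of points of the nested Hilbert scheme of the affine plane\<close>

text \<open>The image of the base ring \<open>B\<close> in \<open>B[x,y]/I\<close>.\<close>

definition scalars :: "'b::comm_ring_1 poly poly set \<Rightarrow> 'b poly poly set set"
  where "scalars I = range (\<lambda>b. I +>\<^bsub>rng\<^esub> const2 b)"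

text \<open>For a field \<open>'b\<close>: the dimension of \<open>B[x,y]/I\<close> over \<open>B\<close> is \<open>n\<close> (in particular finite).\<close>

definition has_colength :: "'b::field poly poly set \<Rightarrow> nat \<Rightarrow> bool"
  where "has_colength I n \<longleftrightarrow> ring.dimension (rng Quot I) n (scalars I) (carrier (rng Quot I))"

text \<open>
  The closed subscheme \<open>V(I)\<close> of the affine plane over \<open>Spec B\<close> is finite and flat of degree \<open>n\<close>
  over \<open>Spec B\<close>.  The degree is that of the fibres over the closed points \<open>\<mm>\<close>, i.e. the dimension of
  \<open>B[x,y]/(I + \<mm>B[x,y])\<close> over \<open>B/\<mm>\<close>.  (For finite flat modules the fibre dimension does not change
  under specialisation, so this determines the degree at all points; the rings \<open>B\<close> used
  below are local Artinian and have no other points.)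
\<close>

definition finite_flat_of_degree :: "nat \<Rightarrow> 'b::comm_ring_1 poly poly set \<Rightarrow> bool"
  where "finite_flat_of_degree n I \<longleftrightarrow>
    (\<exists>Us. set Us \<subseteq> carrier (rng Quot I) \<and>
          ring.Span (rng Quot I) (scalars I) Us = carrier (rng Quot I)) \<and>
    flat_module (quot_module const2 I) \<and>
    (\<forall>\<mm>. maximalideal \<mm> (rng :: 'b ring) \<longrightarrow>
      (let F = genideal rng (I \<union> const2 ` \<mm>)
       in ring.dimension (rng Quot F) n (scalars F) (carrier (rng Quot F))))"

text \<open>
  The \<open>B\<close>-valued points of the nested Hilbert scheme: pairs \<open>(I, J)\<close> of ideals of families
  \<open>\<Z>\<close>, \<open>\<Y>\<close> of degrees \<open>n + 1\<close> and \<open>n\<close> with \<open>\<Y> \<subseteq> \<Z>\<close>, i.e. \<open>I \<subseteq> J\<close>.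
\<close>

definition nested_hilb :: "nat \<Rightarrow> ('b::comm_ring_1 poly poly set \<times> 'b poly poly set) set"
  where "nested_hilb n =
    {(I, J). ideal I rng \<and> ideal J rng \<and> I \<subseteq> J \<and>
             finite_flat_of_degree (n + 1) I \<and> finite_flat_of_degree n J}"

text \<open>Functoriality: pull-back of families along \<open>Spec C \<rightarrow> Spec B\<close>, for a homomorphism \<open>h : B \<rightarrow> C\<close>.\<close>

definition base_change ::
    "('b::comm_ring_1 \<Rightarrow> 'c::comm_ring_1) \<Rightarrow> 'b poly poly set \<Rightarrow> 'c poly poly set"
  where "base_change h I = genideal rng (map_poly (map_poly h) ` I)"

definition pull ::
    "('b::comm_ring_1 \<Rightarrow> 'c::comm_ring_1) \<Rightarrow> 'b poly poly set \<times> 'b poly poly set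
      \<Rightarrow> 'c poly poly set \<times> 'c poly poly set"
  where "pull h = (\<lambda>(I, J). (base_change h I, base_change h J))"


section \<open>Dual numbers\<close>

text \<open>
  For finite \<open>'k\<close>, the ring \<open>\<complex>[\<epsilon>\<^sub>k : k \<in> 'k]/(\<epsilon>\<^sub>k \<epsilon>\<^sub>l : k, l \<in> 'k)\<close>; \<open>Dual a e\<close> is \<open>a + (\<Sum>k. e k \<epsilon>\<^sub>k)\<close>.
  So \<open>unit dual\<close> is \<open>\<complex>[\<epsilon>]/(\<epsilon>\<^sup>2)\<close>, and \<open>bool dual\<close> is \<open>\<complex>[\<epsilon>\<^sub>1,\<epsilon>\<^sub>2]/(\<epsilon>\<^sub>1,\<epsilon>\<^sub>2)\<^sup>2\<close>, the fibre product of two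
  copies of the former over \<open>\<complex>\<close>.
\<close>

datatype 'k dual = Dual (dval: complex) (deps: "'k \<Rightarrow> complex")

instantiation dual :: (type) comm_ring_1
begin

definition zero_dual :: "'a dual" where "0 = Dual 0 (\<lambda>k. 0)"
definition one_dual :: "'a dual" where "1 = Dual 1 (\<lambda>k. 0)"
definition plus_dual :: "'a dual \<Rightarrow> 'a dual \<Rightarrow> 'a dual"
  where "a + b = Dual (dval a + dval b) (\<lambda>k. deps a k + deps b k)"
definition minus_dual :: "'a dual \<Rightarrow> 'a dual \<Rightarrow> 'a dual"
  where "a - b = Dual (dval a - dval b) (\<lambda>k. deps a k - deps b k)"
definition uminus_dual :: "'a dual \<Rightarrow> 'a dual"
  where "- a = Dual (- dval a) (\<lambda>k. - deps a k)"
definition times_dual :: "'a dual \<Rightarrow> 'a dual \<Rightarrow> 'a dual"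
  where "a * b = Dual (dval a * dval b) (\<lambda>k. dval a * deps b k + deps a k * dval b)"

instance
  by standard
    (auto simp: zero_dual_def one_dual_def plus_dual_def minus_dual_def uminus_dual_def
      times_dual_def algebra_simps)

end

definition dual_of_complex :: "complex \<Rightarrow> 'a dual"
  where "dual_of_complex c = Dual c (\<lambda>k. 0)"

text \<open>\<open>\<epsilon> \<mapsto> c\<epsilon>\<close>\<close>

definition dual_scale :: "complex \<Rightarrow> unit dual \<Rightarrow> unit dual"
  where "dual_scale c a = Dual (dval a) (\<lambda>k. c * deps a k)"

text \<open>\<open>\<epsilon>\<^sub>k \<mapsto> \<epsilon>\<close> and \<open>\<epsilon>\<^sub>l \<mapsto> 0\<close> for \<open>l \<noteq> k\<close>\<close>

definition dual_proj :: "bool \<Rightarrow> bool dual \<Rightarrow> unit dual"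
  where "dual_proj k a = Dual (dval a) (\<lambda>_. deps a k)"

text \<open>\<open>\<epsilon>\<^sub>1 \<mapsto> \<epsilon>\<close> and \<open>\<epsilon>\<^sub>2 \<mapsto> \<epsilon>\<close>\<close>

definition dual_sum :: "bool dual \<Rightarrow> unit dual"
  where "dual_sum a = Dual (dval a) (\<lambda>_. deps a False + deps a True)"


section \<open>The tangent space\<close>

text \<open>
  Tangent vectors at the closed point \<open>p = (I, J)\<close>: the points with values in \<open>\<complex>[\<epsilon>]/(\<epsilon>\<^sup>2)\<close> that restrict
  to \<open>p\<close> along \<open>\<epsilon> \<mapsto> 0\<close>.
\<close>

definition tangent_vectors ::
    "nat \<Rightarrow> complex poly poly set \<times> complex poly poly set
      \<Rightarrow> (unit dual poly poly set \<times> unit dual poly poly set) set"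
  where "tangent_vectors n p = {v \<in> nested_hilb n. pull dval v = p}"

text \<open>
  The usual vector space structure on these: scalars act by \<open>\<epsilon> \<mapsto> c\<epsilon>\<close>; two tangent vectors at \<open>p\<close> are the
  two projections of a unique point with values in \<open>\<complex>[\<epsilon>\<^sub>1,\<epsilon>\<^sub>2]/(\<epsilon>\<^sub>1,\<epsilon>\<^sub>2)\<^sup>2\<close>, and their sum is the image of
  that point under \<open>\<epsilon>\<^sub>1, \<epsilon>\<^sub>2 \<mapsto> \<epsilon>\<close>.
\<close>

definition tangent_space ::
    "nat \<Rightarrow> complex poly poly set \<times> complex poly poly set
      \<Rightarrow> (complex, unit dual poly poly set \<times> unit dual poly poly set) module"
  where "tangent_space n p =
    \<lparr>carrier = tangent_vectors n p, monoid.mult = undefined, one = undefined,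
     ring.zero = pull dual_of_complex p,
     add = (\<lambda>v w. pull dual_sum
       (THE u. u \<in> nested_hilb n \<and> pull (dual_proj False) u = v \<and> pull (dual_proj True) u = w)),
     module.smult = (\<lambda>c. pull (dual_scale c))\<rparr>"


section \<open>The map delta\<close>

text \<open>The natural map \<open>R/I \<rightarrow> R/J\<close> for \<open>I \<subseteq> J\<close>, which sends the coset \<open>I + a\<close> to \<open>J + (I + a) = J + a\<close>.\<close>

definition quot_proj :: "'a::comm_ring_1 set \<Rightarrow> 'a set \<Rightarrow> 'a set"
  where "quot_proj J u = J <+>\<^bsub>rng\<^esub> u"

abbreviation Hom_to_quot :: "'a::comm_ring_1 set \<Rightarrow> 'a set \<Rightarrow> ('a, 'a \<Rightarrow> 'a set) module"
  where "Hom_to_quot I J \<equiv> Hom_module rng (ideal_module I) (quot_module (\<lambda>r. r) J)"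

text \<open>\<open>(\<alpha>, \<beta>) \<mapsto> \<pi> \<circ> \<alpha> - \<beta> \<circ> \<iota>\<close>, with \<open>\<iota>\<close> the inclusion of \<open>I\<close> in \<open>J\<close>\<close>

definition delta ::
    "'a::comm_ring_1 set \<Rightarrow> 'a set \<Rightarrow> ('a \<Rightarrow> 'a set) \<times> ('a \<Rightarrow> 'a set) \<Rightarrow> 'a \<Rightarrow> 'a set"
  where "delta I J = (\<lambda>(\<alpha>, \<beta>). \<lambda>a\<in>I. quot_proj J (\<alpha> a) \<ominus>\<^bsub>rng Quot J\<^esub> \<beta> a)"

end

theory Submission
  imports Defs
begin

text \<open>
  A tangent vector at \<open>(I, J)\<close> is a pair of ideals \<open>I' \<subseteq> J'\<close> of \<open>\<complex>[\<epsilon>][x,y]\<close>, with quotients flat over \<open>\<complex>[\<epsilon>]\<close>, that reduce to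
  \<open>I \<subseteq> J\<close>. By flatness, \<open>\<epsilon> g\<close> lies in \<open>I'\<close> only if \<open>g\<close> lies in \<open>I\<close> (\<open>flat_eps_mem\<close>); conversely
  \<open>\<epsilon> I' \<subseteq> I'\<close>. Hence, for \<open>f\<close> in \<open>I\<close>, the \<open>\<epsilon>\<close>-parts
  \<open>e\<close> of the lifts \<open>f + \<epsilon> e\<close> of \<open>f\<close> to \<open>I'\<close> form a single coset of \<open>I\<close>, and \<open>f \<mapsto> e\<close> is a homomorphism \<open>\<alpha> : I \<rightarrow> R/I\<close>.
  Conversely \<open>\<alpha>\<close> determines \<open>I'\<close> as
  \<open>{f + \<epsilon> e. f \<in> I, e represents \<alpha>(f)}\<close> (\<open>flat_imp_deformation\<close>), and every \<open>\<alpha>\<close> occurs, because a basis of \<open>R/I\<close>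
  lifts to a basis of the quotient by this ideal (\<open>finite_flat_deformation\<close>), and finitely generated projective modules are flat
  (\<open>flat_of_dual_basis\<close>). The same holds for \<open>J'\<close> and \<open>\<beta> : J \<rightarrow> R/J\<close>.

  The inclusion \<open>I' \<subseteq> J'\<close> says that every representative of \<open>\<alpha>(f)\<close> also represents \<open>\<beta>(f)\<close>
  (\<open>deformation_subset_iff\<close>), i.e. that \<open>\<pi> \<circ> \<alpha> = \<beta> \<circ> \<iota>\<close>, which is the vanishing of \<open>\<delta>(\<alpha>, \<beta>)\<close> (\<open>kernel_delta_iff\<close>).
  So tangent vectors correspond bijectively to the kernel.

  For the vector space structure, everything above is done over \<open>\<complex>[\<epsilon>\<^sub>k : k \<in> 'k]/(\<epsilon>\<^sub>k \<epsilon>\<^sub>l)\<close> for finite \<open>'k\<close>, where flat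
  families correspond to tuples \<open>(\<alpha>\<^sub>k, \<beta>\<^sub>k)\<close>. Over \<open>\<complex>[\<epsilon>\<^sub>1,\<epsilon>\<^sub>2]\<close> the two projections of a family are the two components
  of the pair, so the point that defines the sum of two tangent vectors exists and is unique, and
  \<open>\<epsilon>\<^sub>1, \<epsilon>\<^sub>2 \<mapsto> \<epsilon>\<close> adds the components; likewise \<open>\<epsilon> \<mapsto> c\<epsilon>\<close> scales by \<open>c\<close> (\<open>base_change_eq_deformation\<close>). The module
  axioms of the tangent space are then inherited from the kernel (\<open>modules_isomorphic_transport\<close>).
\<close>

section \<open>Ideals and cosets in a ring given by a type\<close>

abbreviation coset :: "'a::comm_ring_1 set \<Rightarrow> 'a \<Rightarrow> 'a set"
  where "coset I f \<equiv> I +>\<^bsub>rng\<^esub> f"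

lemma rng_simps [simp]:
  "carrier (rng :: 'a::comm_ring_1 ring) = UNIV"
  "monoid.mult (rng :: 'a ring) = (*)" "one (rng :: 'a ring) = 1"
  "ring.zero (rng :: 'a ring) = 0" "add (rng :: 'a ring) = (+)"
  by (simp_all add: ring_of_type_algebra_def)

lemma cring_rng: "cring (rng :: 'a::comm_ring_1 ring)"
  by (rule cring_from_type_algebra)

lemma ring_rng: "ring (rng :: 'a::comm_ring_1 ring)"
  by (rule ring_from_type_algebra)

lemma a_inv_rng: "\<ominus>\<^bsub>rng\<^esub> (a :: 'a::comm_ring_1) = - a"
proof -
  interpret ring "rng :: 'a ring" by (rule ring_rng)
  show ?thesis using minus_equality[of "-a" a] by simp
qed

lemma ideal_rng_iff:
  "ideal I (rng :: 'a::comm_ring_1 ring) \<longleftrightarrow>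
    0 \<in> I \<and> (\<forall>a\<in>I. \<forall>b\<in>I. a + b \<in> I) \<and> (\<forall>a\<in>I. \<forall>r. r * a \<in> I)"
proof (intro iffI)
  assume "ideal I (rng :: 'a ring)"
  then interpret ideal I "rng :: 'a ring" .
  show "0 \<in> I \<and> (\<forall>a\<in>I. \<forall>b\<in>I. a + b \<in> I) \<and> (\<forall>a\<in>I. \<forall>r. r * a \<in> I)"
    using additive_subgroup.zero_closed[OF is_additive_subgroup]
      additive_subgroup.a_closed[OF is_additive_subgroup] I_l_closed by simp
next
  assume I: "0 \<in> I \<and> (\<forall>a\<in>I. \<forall>b\<in>I. a + b \<in> I) \<and> (\<forall>a\<in>I. \<forall>r. r * a \<in> I)"
  interpret ring "rng :: 'a ring" by (rule ring_rng)
  have inv: "inv\<^bsub>add_monoid (rng :: 'a ring)\<^esub> a \<in> I" if "a \<in> I" for a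
  proof -
    have "- 1 * a \<in> I" using I that by blast
    then show ?thesis using a_inv_rng[of a] by (simp add: a_inv_def)
  qed
  show "ideal I (rng :: 'a ring)"
    by (rule idealI, rule ring_rng, rule subgroup.intro) (use I inv in \<open>auto simp: mult.commute\<close>)
qed

lemma
  assumes "ideal I (rng :: 'a::comm_ring_1 ring)"
  shows ideal_0: "0 \<in> I"
    and ideal_add: "a \<in> I \<Longrightarrow> b \<in> I \<Longrightarrow> a + b \<in> I"
    and ideal_mult: "a \<in> I \<Longrightarrow> r * a \<in> I"
    and ideal_mult2: "a \<in> I \<Longrightarrow> a * r \<in> I"
    and ideal_uminus: "a \<in> I \<Longrightarrow> - a \<in> I"
    and ideal_diff: "a \<in> I \<Longrightarrow> b \<in> I \<Longrightarrow> a - b \<in> I"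
proof -
  have I: "0 \<in> I" "\<And>a b. a \<in> I \<Longrightarrow> b \<in> I \<Longrightarrow> a + b \<in> I" "\<And>a r. a \<in> I \<Longrightarrow> r * a \<in> I"
    using assms unfolding ideal_rng_iff by auto
  have neg: "- a \<in> I" if "a \<in> I" for a using I(3)[OF that, of "- 1"] by simp
  show "0 \<in> I" "a \<in> I \<Longrightarrow> b \<in> I \<Longrightarrow> a + b \<in> I" "a \<in> I \<Longrightarrow> r * a \<in> I" "a \<in> I \<Longrightarrow> - a \<in> I"
    by (fact I neg)+
  show "a \<in> I \<Longrightarrow> a * r \<in> I" using I(3)[of a r] by (simp add: mult.commute)
  show "a \<in> I \<Longrightarrow> b \<in> I \<Longrightarrow> a - b \<in> I" using I(2)[of a "-b"] neg by simp
qed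

lemma ideal_sum:
  assumes "ideal I (rng :: 'a::comm_ring_1 ring)" and "\<And>x. x \<in> A \<Longrightarrow> f x \<in> I"
  shows "(\<Sum>x\<in>A. f x) \<in> I"
  using assms(2) by (induction A rule: infinite_finite_induct) (auto simp: ideal_0 ideal_add assms(1))

lemma ideal_cong:
  assumes "ideal I (rng :: 'a::comm_ring_1 ring)" and "a - b \<in> I"
  shows "a \<in> I \<longleftrightarrow> b \<in> I"
  using ideal_add[OF assms, of b] ideal_diff[OF assms(1) _ assms(2), of a] by auto

lemma mem_coset_iff:
  assumes "ideal I (rng :: 'a::comm_ring_1 ring)"
  shows "g \<in> coset I f \<longleftrightarrow> g - f \<in> I"
  unfolding a_r_coset_def' by (auto simp: algebra_simps intro: bexI[of _ "g - f"])

lemma mem_coset_self: "ideal I (rng :: 'a::comm_ring_1 ring) \<Longrightarrow> f \<in> coset I f"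
  by (simp add: mem_coset_iff ideal_0)

lemma coset_eq_iff:
  assumes "ideal I (rng :: 'a::comm_ring_1 ring)"
  shows "coset I f = coset I g \<longleftrightarrow> f - g \<in> I"
proof
  assume "coset I f = coset I g"
  then show "f - g \<in> I" using mem_coset_self[OF assms, of f] by (simp add: mem_coset_iff assms)
next
  assume fg: "f - g \<in> I"
  have "h - f \<in> I \<longleftrightarrow> h - g \<in> I" for h
    by (rule ideal_cong[OF assms]) (use ideal_uminus[OF assms fg] in simp)
  then show "coset I f = coset I g" by (auto simp: mem_coset_iff assms)
qed

lemma coset_eqI:
  assumes J: "ideal J (rng :: 'a::comm_ring_1 ring)" and "S = coset J e'" and "e \<in> S"
  shows "S = coset J e"
  using assms(2,3) ideal_uminus[OF J, of "e - e'"] by (simp add: mem_coset_iff[OF J] coset_eq_iff[OF J])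

lemma coset_0: "ideal I (rng :: 'a::comm_ring_1 ring) \<Longrightarrow> coset I 0 = I"
  by (auto simp: mem_coset_iff)

lemma
  assumes I: "ideal I (rng :: 'a::comm_ring_1 ring)"
  shows carrier_Quot: "carrier (rng Quot I) = range (coset I)"
    and zero_Quot: "\<zero>\<^bsub>rng Quot I\<^esub> = I"
    and one_Quot: "\<one>\<^bsub>rng Quot I\<^esub> = coset I 1"
    and add_Quot: "coset I f \<oplus>\<^bsub>rng Quot I\<^esub> coset I g = coset I (f + g)"
    and mult_Quot: "coset I f \<otimes>\<^bsub>rng Quot I\<^esub> coset I g = coset I (f * g)"
    and minus_Quot: "coset I f \<ominus>\<^bsub>rng Quot I\<^esub> coset I g = coset I (f - g)"
proof -
  interpret ideal I "rng :: 'a ring" by (rule I)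
  interpret Q: ring "rng Quot I" by (rule quotient_is_ring)
  show car: "carrier (rng Quot I) = range (coset I)"
    by (auto simp: FactRing_def A_RCOSETS_def')
  show "\<zero>\<^bsub>rng Quot I\<^esub> = I" "\<one>\<^bsub>rng Quot I\<^esub> = coset I 1" by (simp_all add: FactRing_simps)
  have add: "coset I f \<oplus>\<^bsub>rng Quot I\<^esub> coset I g = coset I (f + g)" for f g
    using a_rcos_sum[of f g] by (simp add: FactRing_simps)
  show "coset I f \<oplus>\<^bsub>rng Quot I\<^esub> coset I g = coset I (f + g)" by (rule add)
  show "coset I f \<otimes>\<^bsub>rng Quot I\<^esub> coset I g = coset I (f * g)"
    using rcoset_mult_add[of f g] by (simp add: FactRing_simps)
  have "\<ominus>\<^bsub>rng Quot I\<^esub> coset I g = coset I (- g)"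
    using Q.minus_equality[of "coset I (-g)" "coset I g"]
    by (simp add: car add coset_0[OF I]) (simp add: FactRing_simps)
  then show "coset I f \<ominus>\<^bsub>rng Quot I\<^esub> coset I g = coset I (f - g)"
    by (simp add: a_minus_def add)
qed

lemmas Quot_simps = carrier_Quot zero_Quot one_Quot add_Quot mult_Quot minus_Quot

lemma genideal_eq_self:
  assumes "ideal I (rng :: 'a::comm_ring_1 ring)" shows "genideal rng I = I"
  using assms unfolding genideal_def by blast

lemma ideal_genideal: "ideal (genideal rng S) (rng :: 'a::comm_ring_1 ring)"
  using ring.genideal_ideal[OF ring_rng, of S] by simp

lemma subset_genideal: "S \<subseteq> genideal rng S"
  unfolding genideal_def by blast

lemma genideal_subset:
  assumes "ideal I (rng :: 'a::comm_ring_1 ring)" and "S \<subseteq> I"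
  shows "genideal rng S \<subseteq> I"
  using assms unfolding genideal_def by blast

section \<open>Tensor products and flatness\<close>

text \<open>
  Keeps the scalar action \<open>const2 r * f\<close> intact, which is the form in which every linearity
  hypothesis below is stated.
\<close>

declare mult_pCons_left [simp del] mult_pCons_right [simp del]

text \<open>
  The \<open>\<int>\<close>-linear extension of \<open>g\<close> to formal sums. A function on a tensor product is a \<open>frag_lin g\<close>
  with \<open>g\<close> balanced.
\<close>

definition frag_lin :: "('x \<Rightarrow> 'c::comm_ring_1) \<Rightarrow> ('x \<Rightarrow>\<^sub>0 int) \<Rightarrow> 'c"
  where "frag_lin g z = (\<Sum>x\<in>Poly_Mapping.keys z. of_int (Poly_Mapping.lookup z x) * g x)"

lemma frag_lin_superset:
  assumes "finite S" and "Poly_Mapping.keys z \<subseteq> S"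
  shows "frag_lin g z = (\<Sum>x\<in>S. of_int (Poly_Mapping.lookup z x) * g x)"
  unfolding frag_lin_def
  by (rule sum.mono_neutral_left) (use assms in \<open>auto simp: in_keys_iff\<close>)

lemma frag_lin_0 [simp]: "frag_lin g 0 = 0"
  by (simp add: frag_lin_def)

lemma frag_lin_of [simp]: "frag_lin g (frag_of x) = g x"
  by (simp add: frag_lin_def)

lemma frag_lin_add: "frag_lin g (z + w) = frag_lin g z + frag_lin g w"
proof -
  let ?S = "Poly_Mapping.keys z \<union> Poly_Mapping.keys w"
  have "frag_lin g u = (\<Sum>x\<in>?S. of_int (Poly_Mapping.lookup u x) * g x)"
    if "u \<in> {z, w, z + w}" for u
    by (rule frag_lin_superset) (use that Poly_Mapping.keys_add[of z w] in auto)
  then show ?thesis by (simp add: lookup_add algebra_simps sum.distrib)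
qed

lemma frag_lin_uminus: "frag_lin g (- z) = - frag_lin g z"
  using frag_lin_add[of g z "- z"] by (simp add: eq_neg_iff_add_eq_0 add.commute)

lemma frag_lin_diff: "frag_lin g (z - w) = frag_lin g z - frag_lin g w"
  using frag_lin_add[of g z "- w"] by (simp add: frag_lin_uminus)

lemma frag_lin_sum: "frag_lin g (\<Sum>x\<in>A. f x) = (\<Sum>x\<in>A. frag_lin g (f x))"
  by (induction A rule: infinite_finite_induct) (auto simp: frag_lin_add)

lemma quot_module_simps:
  assumes "ideal I (rng :: 'a::comm_ring_1 ring)"
  shows "carrier (quot_module h I) = range (coset I)"
    and "\<zero>\<^bsub>quot_module h I\<^esub> = I"
    and "coset I f \<oplus>\<^bsub>quot_module h I\<^esub> coset I g = coset I (f + g)"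
    and "r \<odot>\<^bsub>quot_module h I\<^esub> coset I f = coset I (h r * f)"
  by (simp_all add: quot_module_def Quot_simps[OF assms])

lemma ideal_module_simps [simp]:
  "carrier (ideal_module I) = I" "\<zero>\<^bsub>ideal_module I\<^esub> = 0"
  "a \<oplus>\<^bsub>ideal_module I\<^esub> b = a + b" "r \<odot>\<^bsub>ideal_module I\<^esub> a = r * a"
  by (simp_all add: ideal_module_def)

abbreviation ideal_tensor_null :: "'b::comm_ring_1 set \<Rightarrow> 'b poly poly set \<Rightarrow> ('b \<times> 'b poly poly set \<Rightarrow>\<^sub>0 int) set"
  where "ideal_tensor_null \<aa> I \<equiv> tensor_null rng (ideal_module \<aa>) (quot_module const2 I)"

text \<open>
  The relations of \<open>tensor_null\<close> for \<open>N = \<aa>\<close> and \<open>M = B[x,y]/I\<close>, with every element of \<open>M\<close> written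
  as the coset of a polynomial, so that relations in \<open>M\<close> can be handled by polynomial arithmetic.
\<close>

definition tensor_rels :: "'b::comm_ring_1 set \<Rightarrow> 'b poly poly set \<Rightarrow> ('b \<times> 'b poly poly set \<Rightarrow>\<^sub>0 int) set"
  where "tensor_rels \<aa> I =
    {frag_of (a + a', coset I f) - frag_of (a, coset I f) - frag_of (a', coset I f) | a a' f.
      a \<in> \<aa> \<and> a' \<in> \<aa>} \<union>
    {frag_of (a, coset I (f + g)) - frag_of (a, coset I f) - frag_of (a, coset I g) | a f g. a \<in> \<aa>} \<union>
    {frag_of (r * a, coset I f) - frag_of (a, coset I (const2 r * f)) | r a f. a \<in> \<aa>}"

lemma ideal_tensor_null_eq:
  fixes I :: "'b::comm_ring_1 poly poly set"
  assumes "ideal I rng"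
  shows "ideal_tensor_null \<aa> I =
    generate (free_Abelian_group (\<aa> \<times> range (coset I))) (tensor_rels \<aa> I)"
proof -
  have car: "m \<in> carrier (quot_module const2 I) \<longleftrightarrow> (\<exists>f. m = coset I f)" for m
    by (auto simp: quot_module_simps(1)[OF assms])
  note ops = quot_module_simps(3,4)[OF assms, where h = const2, symmetric]
  have "{frag_of (x \<oplus>\<^bsub>ideal_module \<aa>\<^esub> x', m) - frag_of (x, m) - frag_of (x', m) | x x' m.
      x \<in> carrier (ideal_module \<aa>) \<and> x' \<in> carrier (ideal_module \<aa>) \<and> m \<in> carrier (quot_module const2 I)}
    = {frag_of (a + a', coset I f) - frag_of (a, coset I f) - frag_of (a', coset I f) | a a' f.
      a \<in> \<aa> \<and> a' \<in> \<aa>}"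
    unfolding car ideal_module_simps by blast
  moreover have "{frag_of (x, m \<oplus>\<^bsub>quot_module const2 I\<^esub> m') - frag_of (x, m) - frag_of (x, m') | x m m'.
      x \<in> carrier (ideal_module \<aa>) \<and> m \<in> carrier (quot_module const2 I) \<and> m' \<in> carrier (quot_module const2 I)}
    = {frag_of (a, coset I (f + g)) - frag_of (a, coset I f) - frag_of (a, coset I g) | a f g. a \<in> \<aa>}"
    unfolding car ideal_module_simps ops by blast
  moreover have "{frag_of (r \<odot>\<^bsub>ideal_module \<aa>\<^esub> x, m) - frag_of (x, r \<odot>\<^bsub>quot_module const2 I\<^esub> m) | r x m.
      r \<in> carrier rng \<and> x \<in> carrier (ideal_module \<aa>) \<and> m \<in> carrier (quot_module const2 I)}
    = {frag_of (r * a, coset I f) - frag_of (a, coset I (const2 r * f)) | r a f. a \<in> \<aa>}"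
    unfolding car ideal_module_simps ops by auto
  ultimately show ?thesis
    unfolding tensor_null_def tensor_rels_def
    by (simp only: quot_module_simps(1)[OF assms] ideal_module_simps)
qed

lemma keys_diff_subset:
  assumes "Poly_Mapping.keys a \<subseteq> S" "Poly_Mapping.keys b \<subseteq> S"
  shows "Poly_Mapping.keys (a - b :: 'x \<Rightarrow>\<^sub>0 int) \<subseteq> S"
  using Poly_Mapping.keys_diff[of a b] assms by blast

lemma tensor_rels_carrier:
  assumes \<aa>: "ideal \<aa> (rng :: 'b::comm_ring_1 ring)"
  shows "tensor_rels \<aa> I \<subseteq> carrier (free_Abelian_group (\<aa> \<times> range (coset I)))"
  unfolding tensor_rels_def Un_subset_iff
  by (intro conjI subsetI; elim CollectE exE conjE;
      simp only: carrier_free_Abelian_group_iff; intro keys_diff_subset)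
    (auto simp: ideal_add[OF \<aa>] ideal_mult[OF \<aa>])

lemma
  fixes I :: "'b::comm_ring_1 poly poly set"
  assumes I: "ideal I rng" and \<aa>: "ideal \<aa> rng"
  shows null_0: "0 \<in> ideal_tensor_null \<aa> I"
    and null_add: "z \<in> ideal_tensor_null \<aa> I \<Longrightarrow> w \<in> ideal_tensor_null \<aa> I \<Longrightarrow> z + w \<in> ideal_tensor_null \<aa> I"
    and null_uminus: "z \<in> ideal_tensor_null \<aa> I \<Longrightarrow> - z \<in> ideal_tensor_null \<aa> I"
    and null_diff: "z \<in> ideal_tensor_null \<aa> I \<Longrightarrow> w \<in> ideal_tensor_null \<aa> I \<Longrightarrow> z - w \<in> ideal_tensor_null \<aa> I"
    and null_rel: "z \<in> tensor_rels \<aa> I \<Longrightarrow> z \<in> ideal_tensor_null \<aa> I"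
proof -
  let ?G = "free_Abelian_group (\<aa> \<times> range (coset I))"
  interpret T: subgroup "ideal_tensor_null \<aa> I" ?G
    unfolding ideal_tensor_null_eq[OF I] by (rule group.generate_is_subgroup) (use tensor_rels_carrier[OF \<aa>] in auto)
  show 0: "0 \<in> ideal_tensor_null \<aa> I" using T.one_closed by simp
  have add: "z + w \<in> ideal_tensor_null \<aa> I" if "z \<in> ideal_tensor_null \<aa> I" "w \<in> ideal_tensor_null \<aa> I" for z w
    using T.m_closed that by simp
  have neg: "- z \<in> ideal_tensor_null \<aa> I" if "z \<in> ideal_tensor_null \<aa> I" for z
  proof -
    have "Poly_Mapping.keys z \<subseteq> \<aa> \<times> range (coset I)"
      using subsetD[OF T.subset that] by (simp only: carrier_free_Abelian_group_iff)
    then show ?thesis using T.m_inv_closed[OF that] by simp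
  qed
  show "z \<in> ideal_tensor_null \<aa> I \<Longrightarrow> w \<in> ideal_tensor_null \<aa> I \<Longrightarrow> z + w \<in> ideal_tensor_null \<aa> I"
    "z \<in> ideal_tensor_null \<aa> I \<Longrightarrow> - z \<in> ideal_tensor_null \<aa> I" by (fact add neg)+
  show "z \<in> ideal_tensor_null \<aa> I \<Longrightarrow> w \<in> ideal_tensor_null \<aa> I \<Longrightarrow> z - w \<in> ideal_tensor_null \<aa> I"
    using add[of z "- w"] neg[of w] by simp
  show "z \<in> tensor_rels \<aa> I \<Longrightarrow> z \<in> ideal_tensor_null \<aa> I"
    unfolding ideal_tensor_null_eq[OF I] by (rule generate.incl)
qed

lemma
  fixes I :: "'b::comm_ring_1 poly poly set"
  assumes I: "ideal I rng" and \<aa>: "ideal \<aa> rng" and a: "a \<in> \<aa>"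
  shows null_add_left: "a' \<in> \<aa> \<Longrightarrow>
      frag_of (a + a', coset I f) - frag_of (a, coset I f) - frag_of (a', coset I f) \<in> ideal_tensor_null \<aa> I"
    and null_add_right:
      "frag_of (a, coset I (f + g)) - frag_of (a, coset I f) - frag_of (a, coset I g) \<in> ideal_tensor_null \<aa> I"
    and null_scale:
      "frag_of (r * a, coset I f) - frag_of (a, coset I (const2 r * f)) \<in> ideal_tensor_null \<aa> I"
  by (rule null_rel[OF I \<aa>], unfold tensor_rels_def, use a in blast)+

lemma null_zero_left:
  fixes I :: "'b::comm_ring_1 poly poly set"
  assumes I: "ideal I rng" and \<aa>: "ideal \<aa> rng"
  shows "frag_of (0, coset I f) \<in> ideal_tensor_null \<aa> I"
  using null_uminus[OF I \<aa> null_add_left[OF I \<aa>, of 0 0 f]] ideal_0[OF \<aa>] by simp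

lemma null_zero_right:
  fixes I :: "'b::comm_ring_1 poly poly set"
  assumes I: "ideal I rng" and \<aa>: "ideal \<aa> rng" and "a \<in> \<aa>"
  shows "frag_of (a, coset I 0) \<in> ideal_tensor_null \<aa> I"
  using null_uminus[OF I \<aa> null_add_right[OF I \<aa>, of a 0 0]] assms by simp

lemma null_sum:
  fixes I :: "'b::comm_ring_1 poly poly set"
  assumes I: "ideal I rng" and \<aa>: "ideal \<aa> rng"
    and "\<And>x. x \<in> A \<Longrightarrow> h x \<in> ideal_tensor_null \<aa> I"
  shows "(\<Sum>x\<in>A. h x) \<in> ideal_tensor_null \<aa> I"
  using assms(3)
  by (induction A rule: infinite_finite_induct) (auto simp: null_0[OF I \<aa>] intro!: null_add[OF I \<aa>])

text \<open>
  The universal property of the tensor product, with values taken modulo an ideal \<open>L\<close>: a function \<open>g\<close> that is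
  balanced modulo \<open>L\<close> descends to \<open>\<aa> \<otimes> M\<close>. Working modulo \<open>L\<close> allows \<open>g\<close> to be defined
  through representatives of cosets.
\<close>

lemma frag_lin_null:
  fixes I :: "'b::comm_ring_1 poly poly set" and L :: "'c::comm_ring_1 set"
  assumes I: "ideal I rng" and L: "ideal L rng"
    and 1: "\<And>a a' f. a \<in> \<aa> \<Longrightarrow> a' \<in> \<aa> \<Longrightarrow> g (a + a', coset I f) - g (a, coset I f) - g (a', coset I f) \<in> L"
    and 2: "\<And>a f h. a \<in> \<aa> \<Longrightarrow> g (a, coset I (f + h)) - g (a, coset I f) - g (a, coset I h) \<in> L"
    and 3: "\<And>a r f. a \<in> \<aa> \<Longrightarrow> g (r * a, coset I f) - g (a, coset I (const2 r * f)) \<in> L"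
    and \<aa>: "ideal \<aa> rng" and z: "z \<in> ideal_tensor_null \<aa> I"
  shows "frag_lin g z \<in> L"
proof -
  let ?G = "free_Abelian_group (\<aa> \<times> range (coset I))"
  let ?H = "{z \<in> carrier ?G. frag_lin g z \<in> L}"
  interpret G: group ?G by simp
  have "subgroup ?H ?G"
  proof (rule G.subgroupI)
    show "?H \<noteq> {}" by (auto simp: ideal_0[OF L] intro!: exI[of _ 0])
    show "inv\<^bsub>?G\<^esub> z \<in> ?H" if "z \<in> ?H" for z
      using that by (simp add: frag_lin_uminus ideal_uminus[OF L])
    show "z \<otimes>\<^bsub>?G\<^esub> w \<in> ?H" if "z \<in> ?H" "w \<in> ?H" for z w
      using that Poly_Mapping.keys_add[of z w] by (auto simp: frag_lin_add ideal_add[OF L])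
  qed auto
  moreover have "tensor_rels \<aa> I \<subseteq> ?H"
  proof -
    have "frag_lin g z \<in> L" if "z \<in> tensor_rels \<aa> I" for z
      using that 1 2 3 by (auto simp: tensor_rels_def frag_lin_diff)
    then show ?thesis using tensor_rels_carrier[OF \<aa>, of I] by blast
  qed
  ultimately have "ideal_tensor_null \<aa> I \<subseteq> ?H"
    unfolding ideal_tensor_null_eq[OF I] using G.generate_subgroup_incl by blast
  with z show ?thesis by blast
qed

lemma rep_coset:
  assumes "ideal I (rng :: 'a::comm_ring_1 ring)"
  shows "(SOME h. h \<in> coset I f) - f \<in> I"
  using someI[of "\<lambda>h. h \<in> coset I f", OF mem_coset_self[OF assms]] mem_coset_iff[OF assms] by blast

lemma null_linear_combination:
  fixes I :: "'b::comm_ring_1 poly poly set" and m :: nat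
  assumes I: "ideal I rng" and \<aa>: "ideal \<aa> rng" and a: "a \<in> \<aa>"
  shows "frag_of (a, coset I (\<Sum>i<m. const2 (c i) * e i)) - (\<Sum>i<m. frag_of (c i * a, coset I (e i)))
    \<in> ideal_tensor_null \<aa> I"
proof (induction m)
  case 0
  show ?case using null_zero_right[OF I \<aa> a] by simp
next
  case (Suc m)
  let ?s = "\<Sum>i<m. const2 (c i) * e i" and ?t = "\<Sum>i<m. frag_of (c i * a, coset I (e i))"
  have "(frag_of (a, coset I (?s + const2 (c m) * e m)) - frag_of (a, coset I ?s)
      - frag_of (a, coset I (const2 (c m) * e m)))
    + (frag_of (a, coset I ?s) - ?t)
    - (frag_of (c m * a, coset I (e m)) - frag_of (a, coset I (const2 (c m) * e m)))
    \<in> ideal_tensor_null \<aa> I"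
    by (intro null_add[OF I \<aa>] null_diff[OF I \<aa>] null_add_right null_scale I \<aa> a Suc)
  then show ?case by (simp add: algebra_simps)
qed

text \<open>
  Finitely generated projective modules are flat, in terms of a dual basis \<open>(e\<^sub>i, c\<^sub>i)\<close> of \<open>M = B[x,y]/I\<close>:
  the coordinate \<open>c\<^sub>i\<close> induces \<open>L\<^sub>i : \<aa> \<otimes> M \<rightarrow> \<aa>, a \<otimes> m \<mapsto> a c\<^sub>i(m)\<close>, and every \<open>z\<close> in \<open>\<aa> \<otimes> M\<close> equals
  \<open>\<Sum>\<^sub>i L\<^sub>i(z) \<otimes> e\<^sub>i\<close>. But \<open>L\<^sub>i(z)\<close> depends only on the image of \<open>z\<close> in \<open>B \<otimes> M\<close>, so \<open>z = 0\<close> as soon as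
  that image vanishes.
\<close>

lemma flat_of_dual_basis:
  fixes I :: "'b::comm_ring_1 poly poly set" and n :: nat
  assumes I: "ideal I rng"
    and c_add: "\<And>i f g. c i (f + g) = c i f + c i g"
    and c_scale: "\<And>i r f. c i (const2 r * f) = r * c i f"
    and c_I: "\<And>i f. f \<in> I \<Longrightarrow> c i f = 0"
    and basis: "\<And>f. f - (\<Sum>i<n. const2 (c i f) * e i) \<in> I"
  shows "flat_module (quot_module const2 I)"
  unfolding flat_module_def
proof (intro allI impI subsetI)
  fix \<aa> :: "'b set" and z
  assume \<aa>: "ideal \<aa> rng"
    and "z \<in> carrier (free_Abelian_group (\<aa> \<times> carrier (quot_module const2 I))) \<inter> ideal_tensor_null UNIV I"
  then have keys: "Poly_Mapping.keys z \<subseteq> \<aa> \<times> range (coset I)" and z: "z \<in> ideal_tensor_null UNIV I"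
    by (auto simp: quot_module_simps[OF I])
  define L where "L i = frag_lin (\<lambda>(b, u). b * c i (SOME h. h \<in> u))" for i
  have c_rep: "c i (SOME h. h \<in> coset I f) = c i f" for i f
    using c_add[of i "(SOME h. h \<in> coset I f) - f" f] c_I[OF rep_coset[OF I, of f]] by simp
  have UNIV: "ideal UNIV (rng :: 'b ring)" and null: "ideal {0} (rng :: 'b ring)"
    by (auto simp: ideal_rng_iff)
  have L0: "L i z = 0" for i
  proof -
    have "L i z \<in> {0}" unfolding L_def
      by (rule frag_lin_null[OF I null _ _ _ UNIV z])
        (simp_all add: c_rep c_add c_scale distrib_left distrib_right mult.assoc mult.left_commute)
    then show ?thesis by simp
  qed
  have "(\<forall>i. L i z \<in> \<aa>) \<and> z - (\<Sum>i<n. frag_of (L i z, coset I (e i))) \<in> ideal_tensor_null \<aa> I"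
    using keys
  proof (induction z rule: frag_induction)
    case zero
    have "(\<Sum>i<n. frag_of (0, coset I (e i))) \<in> ideal_tensor_null \<aa> I"
      by (intro null_sum null_zero_left I \<aa>)
    from null_uminus[OF I \<aa> this] show ?case by (simp add: L_def ideal_0[OF \<aa>])
  next
    case (one x)
    then obtain a f where x: "x = (a, coset I f)" "a \<in> \<aa>" by auto
    have f: "coset I f = coset I (\<Sum>i<n. const2 (c i f) * e i)"
      unfolding coset_eq_iff[OF I] by (rule basis)
    have "frag_of (a, coset I f) - (\<Sum>i<n. frag_of (c i f * a, coset I (e i))) \<in> ideal_tensor_null \<aa> I"
      by (subst f) (rule null_linear_combination[OF I \<aa> x(2)])
    moreover have "a * c i f \<in> \<aa>" for i
      by (rule ideal_mult2[OF \<aa> x(2)])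
    ultimately show ?case using x by (simp add: L_def c_rep mult.commute)
  next
    case (diff a b)
    have L_diff: "L i (a - b) = L i a - L i b" for i
      by (simp add: L_def frag_lin_diff)
    (* By biadditivity this difference vanishes in the tensor product; it converts the expansions of
       a and b into that of a - b. *)
    let ?s = "\<lambda>i. frag_of (L i a, coset I (e i)) - frag_of (L i a - L i b, coset I (e i))
      - frag_of (L i b, coset I (e i))"
    have mem: "L i a \<in> \<aa>" "L i b \<in> \<aa>" "L i a - L i b \<in> \<aa>" for i
      using diff by (auto intro: ideal_diff[OF \<aa>])
    have "?s i \<in> ideal_tensor_null \<aa> I" for i
      using null_add_left[OF I \<aa> mem(3) mem(2), of i i "e i"] by simp
    then have "(\<Sum>i<n. ?s i) \<in> ideal_tensor_null \<aa> I"
      by (intro null_sum I \<aa>)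
    with diff have "(a - (\<Sum>i<n. frag_of (L i a, coset I (e i)))) - (b - (\<Sum>i<n. frag_of (L i b, coset I (e i))))
      + (\<Sum>i<n. ?s i) \<in> ideal_tensor_null \<aa> I"
      by (intro null_add[OF I \<aa> null_diff[OF I \<aa>]]) auto
    then show ?case using mem by (simp add: L_diff sum_subtractf sum.distrib algebra_simps)
  qed
  then have "z - (\<Sum>i<n. frag_of (0, coset I (e i))) \<in> ideal_tensor_null \<aa> I"
    by (simp add: L0)
  moreover have "(\<Sum>i<n. frag_of (0, coset I (e i))) \<in> ideal_tensor_null \<aa> I"
    by (intro null_sum null_zero_left I \<aa>)
  ultimately show "z \<in> ideal_tensor_null \<aa> I"
    using null_add[OF I \<aa>] by fastforce
qed


text \<open>
  How flatness is used: a linear relation \<open>\<Sum> a\<^sub>k m\<^sub>k = 0\<close> in \<open>M\<close> with \<open>a\<^sub>k\<close> in \<open>\<aa>\<close> already holds as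
  \<open>\<Sum> a\<^sub>k \<otimes> m\<^sub>k = 0\<close> in \<open>\<aa> \<otimes> M\<close>, since its image \<open>1 \<otimes> \<Sum> a\<^sub>k m\<^sub>k\<close> in \<open>B \<otimes> M\<close> vanishes.
\<close>

lemma flat_relation:
  fixes I :: "'b::comm_ring_1 poly poly set"
  assumes flat: "flat_module (quot_module const2 I)" and I: "ideal I rng" and \<aa>: "ideal \<aa> rng"
    and a: "\<And>k. k \<in> A \<Longrightarrow> a k \<in> \<aa>" and sum: "(\<Sum>k\<in>A. const2 (a k) * f k) \<in> I"
  shows "(\<Sum>k\<in>A. frag_of (a k, coset I (f k))) \<in> ideal_tensor_null \<aa> I"
proof -
  have UNIV: "ideal UNIV (rng :: 'b ring)" by (auto simp: ideal_rng_iff)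
  have "(\<Sum>k\<in>A. frag_of (a k, coset I (f k))) - frag_of (1, coset I (\<Sum>k\<in>A. const2 (a k) * f k))
    \<in> ideal_tensor_null UNIV I"
  proof (induction A rule: infinite_finite_induct)
    case (insert k A)
    let ?s = "\<Sum>k\<in>A. const2 (a k) * f k"
    have "(frag_of (a k * 1, coset I (f k)) - frag_of (1, coset I (const2 (a k) * f k)))
      + ((\<Sum>k\<in>A. frag_of (a k, coset I (f k))) - frag_of (1, coset I ?s))
      - (frag_of (1, coset I (const2 (a k) * f k + ?s)) - frag_of (1, coset I (const2 (a k) * f k))
        - frag_of (1, coset I ?s)) \<in> ideal_tensor_null UNIV I"
      by (intro null_add[OF I UNIV] null_diff[OF I UNIV] null_scale null_add_right I UNIV insert.IH UNIV_I)
    then show ?case using insert.hyps by (simp add: algebra_simps)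
  qed (use null_uminus[OF I UNIV null_zero_right[OF I UNIV, of 1]] in auto)
  moreover have "coset I (\<Sum>k\<in>A. const2 (a k) * f k) = coset I 0"
    unfolding coset_eq_iff[OF I] using sum by simp
  ultimately have "(\<Sum>k\<in>A. frag_of (a k, coset I (f k))) \<in> ideal_tensor_null UNIV I"
    using null_add[OF I UNIV _ null_zero_right[OF I UNIV, of 1]] by fastforce
  moreover have "(\<Sum>k\<in>A. frag_of (a k, coset I (f k)))
    \<in> carrier (free_Abelian_group (\<aa> \<times> carrier (quot_module const2 I)))"
    by (rule sum_closed_free_Abelian_group)
      (simp add: quot_module_simps[OF I] a)
  ultimately show ?thesis using flat \<aa> unfolding flat_module_def by blast
qed

section \<open>Span and dimension\<close>

lemma ring_Quot: "ideal I (rng :: 'a::comm_ring_1 ring) \<Longrightarrow> ring (rng Quot I)"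
  by (rule ideal.quotient_is_ring)

lemma Span_of_generators:
  fixes I :: "'b::comm_ring_1 poly poly set" and n :: nat
  assumes I: "ideal I rng" and gen: "\<And>f. f - (\<Sum>i<n. const2 (c i f) * e i) \<in> I"
  shows "\<exists>Us. set Us \<subseteq> carrier (rng Quot I) \<and>
    ring.Span (rng Quot I) (scalars I) Us = carrier (rng Quot I)"
proof -
  interpret Q: ring "rng Quot I" by (rule ring_Quot[OF I])
  let ?U = "\<lambda>m. map (\<lambda>i. coset I (e i)) (rev [0..<m])"
  have sub: "set (?U m) \<subseteq> carrier (rng Quot I)" for m
    by (auto simp: carrier_Quot[OF I])
  have mem: "coset I (\<Sum>i<m. const2 (d i) * e i) \<in> Q.Span (scalars I) (?U m)" for m d
  proof (induction m)
    case 0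
    then show ?case by (simp add: zero_Quot[OF I] coset_0[OF I])
  next
    case (Suc m)
    have "coset I (\<Sum>i<Suc m. const2 (d i) * e i) =
        coset I (const2 (d m)) \<otimes>\<^bsub>rng Quot I\<^esub> coset I (e m) \<oplus>\<^bsub>rng Quot I\<^esub> coset I (\<Sum>i<m. const2 (d i) * e i)"
      by (simp add: mult_Quot[OF I] add_Quot[OF I] add.commute)
    with Suc show ?case by (auto simp: Q.line_extension_mem_iff scalars_def)
  qed
  have "Q.Span (scalars I) (?U n) = carrier (rng Quot I)"
  proof
    have "Q.Span (scalars I) Us \<subseteq> carrier (rng Quot I)" if "set Us \<subseteq> carrier (rng Quot I)" for Us
      using that
    proof (induction Us)
      case (Cons u Us)
      have "scalars I \<subseteq> carrier (rng Quot I)" by (auto simp: scalars_def carrier_Quot[OF I])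
      with Cons show ?case by (auto simp: Q.line_extension_mem_iff subset_iff)
    qed simp
    then show "Q.Span (scalars I) (?U n) \<subseteq> carrier (rng Quot I)" using sub by blast
    show "carrier (rng Quot I) \<subseteq> Q.Span (scalars I) (?U n)"
    proof
      fix u assume "u \<in> carrier (rng Quot I)"
      then obtain f where u: "u = coset I f" by (auto simp: carrier_Quot[OF I])
      have "u = coset I (\<Sum>i<n. const2 (c i f) * e i)"
        unfolding u coset_eq_iff[OF I] by (rule gen)
      then show "u \<in> Q.Span (scalars I) (?U n)" using mem by simp
    qed
  qed
  with sub show ?thesis by blast
qed

text \<open>
  If \<open>I\<close> is the unit ideal, which has colength zero, then the image of \<open>B\<close> in \<open>B[x,y]/I\<close> is the zero ring and not a
  subfield. To include this case, the basis is built by induction on the definition of \<open>dimension\<close> instead of using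
  linear algebra over subfields.
\<close>

lemma dimension_basis:
  fixes I :: "'b::field poly poly set"
  assumes I: "ideal I rng" and dim: "ring.dimension (rng Quot I) n (scalars I) E"
  shows "\<exists>e. E = range (\<lambda>d. coset I (\<Sum>i<n. const2 (d i) * e i)) \<and>
    (\<forall>d. (\<Sum>i<n. const2 (d i) * e i) \<in> I \<longrightarrow> (\<forall>i<n. d i = 0))"
proof -
  interpret Q: ring "rng Quot I" by (rule ring_Quot[OF I])
  show ?thesis using dim
  proof (induction n "scalars I" E rule: Q.dimension.induct)
    case zero_dim
    show ?case by (simp add: zero_Quot[OF I] coset_0[OF I])
  next
    case (Suc_dim v E n)
    obtain w where v: "v = coset I w" using Suc_dim(1) by (auto simp: carrier_Quot[OF I])
    obtain e where E: "E = range (\<lambda>d. coset I (\<Sum>i<n. const2 (d i) * e i))"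
      and ind: "\<And>d. (\<Sum>i<n. const2 (d i) * e i) \<in> I \<Longrightarrow> \<forall>i<n. d i = 0"
      using Suc_dim by blast
    let ?e = "e(n := w)"
    have sum: "(\<Sum>i<Suc n. const2 (d i) * ?e i) = const2 (d n) * w + (\<Sum>i<n. const2 (d i) * e i)" for d
      by (simp add: add.commute)
    have "Q.line_extension (scalars I) v E = range (\<lambda>d. coset I (\<Sum>i<Suc n. const2 (d i) * ?e i))"
    proof (intro Set.set_eqI iffI)
      fix u assume "u \<in> Q.line_extension (scalars I) v E"
      then obtain k d where "u = coset I (const2 k) \<otimes>\<^bsub>rng Quot I\<^esub> v \<oplus>\<^bsub>rng Quot I\<^esub> coset I (\<Sum>i<n. const2 (d i) * e i)"
        by (auto simp: Q.line_extension_mem_iff scalars_def E)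
      then have "u = coset I (\<Sum>i<Suc n. const2 ((d(n := k)) i) * ?e i)"
        unfolding sum by (simp add: v mult_Quot[OF I] add_Quot[OF I])
      then show "u \<in> range (\<lambda>d. coset I (\<Sum>i<Suc n. const2 (d i) * ?e i))" by blast
    next
      fix u assume "u \<in> range (\<lambda>d. coset I (\<Sum>i<Suc n. const2 (d i) * ?e i))"
      then obtain d where "u = coset I (const2 (d n) * w + (\<Sum>i<n. const2 (d i) * e i))"
        unfolding sum by blast
      then have "u = coset I (const2 (d n)) \<otimes>\<^bsub>rng Quot I\<^esub> v \<oplus>\<^bsub>rng Quot I\<^esub> coset I (\<Sum>i<n. const2 (d i) * e i)"
        by (simp add: v mult_Quot[OF I] add_Quot[OF I])
      then show "u \<in> Q.line_extension (scalars I) v E"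
        unfolding Q.line_extension_mem_iff scalars_def E by blast
    qed
    moreover have "\<forall>i<Suc n. d i = 0" if d: "(\<Sum>i<Suc n. const2 (d i) * ?e i) \<in> I" for d
    proof -
      have "d n = 0"
      proof (rule ccontr)
        assume nz: "d n \<noteq> 0"
        (* Solving the relation for w expresses v through the previous basis vectors. *)
        let ?k = "- inverse (d n)"
        have "const2 ?k * (const2 (d n) * w + (\<Sum>i<n. const2 (d i) * e i)) \<in> I"
          using ideal_mult[OF I d[unfolded sum]] by simp
        moreover have "const2 ?k * const2 (d n) = - 1"
          using nz by (simp add: mult_pCons_left one_pCons)
        then have "const2 ?k * (const2 (d n) * w) = - w"
          by (simp only: mult.assoc[symmetric]) simp
        moreover have "const2 ?k * (\<Sum>i<n. const2 (d i) * e i) = (\<Sum>i<n. const2 (?k * d i) * e i)"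
          by (simp add: sum_distrib_left mult.assoc[symmetric] mult_pCons_left mult.commute[of _ "d _"])
        ultimately have "- w + (\<Sum>i<n. const2 (?k * d i) * e i) \<in> I"
          by (simp only: distrib_left)
        then have "v = coset I (\<Sum>i<n. const2 (?k * d i) * e i)"
          unfolding v coset_eq_iff[OF I] using ideal_uminus[OF I] by fastforce
        then have "v \<in> E" unfolding E by (intro range_eqI[where x = "\<lambda>i. ?k * d i"])
        with Suc_dim(2) show False by blast
      qed
      then show ?thesis using d[unfolded sum] ind[of d] by (simp add: less_Suc_eq)
    qed
    ultimately show ?case by blast
  qed
qed

text \<open>
  The coordinate functions of a basis of \<open>B[x,y]/I\<close>, as functions of polynomials. They form a dual basis in
  the sense of \<open>flat_of_dual_basis\<close>, and are the input from which dual bases over the dual numbers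
  are constructed.
\<close>

lemma colength_coordinates:
  fixes I :: "'b::field poly poly set"
  assumes I: "ideal I rng" and "has_colength I n"
  shows "\<exists>c e. (\<forall>i f g. c i (f + g) = c i f + c i g) \<and> (\<forall>i r f. c i (const2 r * f) = r * c i f) \<and>
    (\<forall>i. \<forall>f\<in>I. c i f = 0) \<and> (\<forall>f. f - (\<Sum>i<n. const2 (c i f) * e i) \<in> I)"
proof -
  obtain e where E: "range (coset I) = range (\<lambda>d. coset I (\<Sum>i<n. const2 (d i) * e i))"
    and ind: "\<And>d. (\<Sum>i<n. const2 (d i) * e i) \<in> I \<Longrightarrow> \<forall>i<n. d i = 0"
    using dimension_basis[OF I assms(2)[unfolded has_colength_def]] carrier_Quot[OF I] by auto
  have ex: "\<exists>d. f - (\<Sum>i<n. const2 (d i) * e i) \<in> I \<and> (\<forall>i\<ge>n. d i = 0)" for f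
  proof -
    obtain d where "coset I f = coset I (\<Sum>i<n. const2 (d i) * e i)" using E by blast
    then show ?thesis
      by (intro exI[of _ "\<lambda>i. if i < n then d i else 0"]) (simp add: coset_eq_iff[OF I])
  qed
  define c where "c i f = (SOME d. f - (\<Sum>i<n. const2 (d i) * e i) \<in> I \<and> (\<forall>i\<ge>n. d i = 0)) i" for i f
  have c: "f - (\<Sum>i<n. const2 (c i f) * e i) \<in> I" "\<forall>i\<ge>n. c i f = 0" for f
    using someI_ex[OF ex[of f]] unfolding c_def by blast+
  have uniq: "c i f = d i" if "f - (\<Sum>i<n. const2 (d i) * e i) \<in> I" "\<forall>i\<ge>n. d i = 0" for f d i
  proof (cases "i < n")
    case True
    have "(\<Sum>i<n. const2 (c i f - d i) * e i) =
      (f - (\<Sum>i<n. const2 (d i) * e i)) - (f - (\<Sum>i<n. const2 (c i f) * e i))"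
      unfolding diff_pCons[symmetric] by (simp add: sum_subtractf[symmetric] left_diff_distrib[symmetric])
    then have "(\<Sum>i<n. const2 (c i f - d i) * e i) \<in> I"
      using ideal_diff[OF I that(1) c(1)[of f]] by simp
    from ind[OF this] True show ?thesis by simp
  qed (use c that in auto)
  show ?thesis
  proof (intro exI[of _ c] exI[of _ e] conjI allI ballI)
    show "f - (\<Sum>i<n. const2 (c i f) * e i) \<in> I" for f by (rule c)
    show "c i f = 0" if "f \<in> I" for i f by (rule uniq[where d = "\<lambda>_. 0"]) (use that in auto)
    show "c i (f + g) = c i f + c i g" for i f g
    proof (rule uniq)
      have "const2 (c i f + c i g) * e i = const2 (c i f) * e i + const2 (c i g) * e i" for i
        by (simp flip: distrib_right)
      then show "f + g - (\<Sum>i<n. const2 (c i f + c i g) * e i) \<in> I"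
        using ideal_add[OF I c(1)[of f] c(1)[of g]] by (simp add: sum.distrib algebra_simps)
    qed (use c in auto)
    show "c i (const2 r * f) = r * c i f" for i r f
    proof (rule uniq)
      have eq: "const2 (r * c i f) * e i = const2 r * (const2 (c i f) * e i)" for i
        by (simp add: mult.assoc[symmetric] mult_pCons_left mult.commute[of r])
      then show "const2 r * f - (\<Sum>i<n. const2 (r * c i f) * e i) \<in> I"
        using ideal_mult[OF I c(1)[of f], of "const2 r"]
        by (simp only: right_diff_distrib sum_distrib_left eq)
    qed (use c in auto)
  qed
qed

text \<open>
  A surjection \<open>h\<close> induces an isomorphism \<open>A[x,y]/h\<^sup>-\<^sup>1(I) \<cong> B[x,y]/I\<close> that carries scalars onto scalars, and
  the inductive construction of a basis can be lifted along it step by step.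
\<close>

lemma dimension_vimage:
  fixes h :: "'a::comm_ring_1 poly poly \<Rightarrow> 'b::comm_ring_1 poly poly" and g :: "'a \<Rightarrow> 'b"
  assumes h_add: "\<And>p q. h (p + q) = h p + h q" and h_mult: "\<And>p q. h (p * q) = h p * h q"
    and h_const: "\<And>a. h (const2 a) = const2 (g a)" and "surj h" "surj g"
    and I: "ideal I rng" and dim: "ring.dimension (rng Quot I) n (scalars I) (carrier (rng Quot I))"
  shows "ring.dimension (rng Quot (h -` I)) n (scalars (h -` I)) (carrier (rng Quot (h -` I)))"
proof -
  have h0: "h 0 = 0" using h_add[of 0 0] by simp
  have h_diff: "h (p - q) = h p - h q" for p q using h_add[of "p - q" q] by simp
  let ?F = "h -` I"
  have F: "ideal ?F rng"
    using I unfolding ideal_rng_iff by (simp add: h0 h_add h_mult)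
  interpret Q: ring "rng Quot I" by (rule ring_Quot[OF I])
  interpret P: ring "rng Quot ?F" by (rule ring_Quot[OF F])
  have eq: "coset ?F p = coset ?F q \<longleftrightarrow> coset I (h p) = coset I (h q)" for p q
    by (simp add: coset_eq_iff I F h_diff)
  have "E \<subseteq> carrier (rng Quot I) \<and> P.dimension n (scalars ?F) {coset ?F p | p. coset I (h p) \<in> E}"
    if "Q.dimension n (scalars I) E" for E
    using that
  proof (induction n "scalars I" E rule: Q.dimension.induct)
    case zero_dim
    have "{coset ?F p | p. coset I (h p) \<in> {I}} = {coset ?F 0}"
      using eq[of _ 0] by (auto simp: h0 coset_0[OF I])
    then show ?case using P.zero_dim[of "scalars ?F"] Q.zero_closed
      by (simp add: zero_Quot I F coset_0[OF F])
  next
    case (Suc_dim v E n)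
    obtain w where v: "v = coset I (h w)"
      using Suc_dim(1) \<open>surj h\<close> by (metis carrier_Quot[OF I] imageE surjD)
    let ?E = "{coset ?F p | p. coset I (h p) \<in> E}"
    have "coset ?F w \<notin> ?E"
      using Suc_dim(2) by (auto simp: v eq)
    then have "P.dimension (Suc n) (scalars ?F) (P.line_extension (scalars ?F) (coset ?F w) ?E)"
      by (intro P.Suc_dim) (use Suc_dim in \<open>auto simp: carrier_Quot[OF F]\<close>)
    moreover have "P.line_extension (scalars ?F) (coset ?F w) ?E =
      {coset ?F p | p. coset I (h p) \<in> Q.line_extension (scalars I) v E}"
    proof (intro Set.set_eqI iffI)
      fix u assume "u \<in> P.line_extension (scalars ?F) (coset ?F w) ?E"
      then obtain a p where a: "coset I (h p) \<in> E"
        "u = coset ?F (const2 a) \<otimes>\<^bsub>rng Quot ?F\<^esub> coset ?F w \<oplus>\<^bsub>rng Quot ?F\<^esub> coset ?F p"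
        by (auto simp: P.line_extension_mem_iff scalars_def)
      have "coset I (h (const2 a * w + p)) =
          coset I (const2 (g a)) \<otimes>\<^bsub>rng Quot I\<^esub> v \<oplus>\<^bsub>rng Quot I\<^esub> coset I (h p)"
        by (simp add: h_add h_mult h_const v mult_Quot[OF I] add_Quot[OF I])
      then have "coset I (h (const2 a * w + p)) \<in> Q.line_extension (scalars I) v E"
        unfolding Q.line_extension_mem_iff scalars_def using a(1) by blast
      then show "u \<in> {coset ?F p | p. coset I (h p) \<in> Q.line_extension (scalars I) v E}"
        using a(2) by (auto simp: mult_Quot[OF F] add_Quot[OF F])
    next
      fix u assume "u \<in> {coset ?F p | p. coset I (h p) \<in> Q.line_extension (scalars I) v E}"
      then obtain p k y where p: "u = coset ?F p" and y: "y \<in> E"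
        "coset I (h p) = coset I (const2 k) \<otimes>\<^bsub>rng Quot I\<^esub> v \<oplus>\<^bsub>rng Quot I\<^esub> y"
        by (auto simp: Q.line_extension_mem_iff scalars_def)
      have "y \<in> carrier (rng Quot I)"
        using Suc_dim y(1) by blast
      then obtain q where q: "y = coset I (h q)"
        using \<open>surj h\<close> by (metis carrier_Quot[OF I] imageE surjD)
      obtain a where "k = g a" using \<open>surj g\<close> by (metis surjD)
      then have "coset I (h p) = coset I (h (const2 a * w + q))"
        by (simp add: y q h_add h_mult h_const v mult_Quot[OF I] add_Quot[OF I])
      then have "u = coset ?F (const2 a) \<otimes>\<^bsub>rng Quot ?F\<^esub> coset ?F w \<oplus>\<^bsub>rng Quot ?F\<^esub> coset ?F q"
        unfolding p by (simp add: eq mult_Quot[OF F] add_Quot[OF F])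
      then show "u \<in> P.line_extension (scalars ?F) (coset ?F w) ?E"
        using y(1) unfolding P.line_extension_mem_iff scalars_def q by blast
    qed
    moreover have "scalars I \<subseteq> carrier (rng Quot I)" by (auto simp: scalars_def carrier_Quot[OF I])
    then have "Q.line_extension (scalars I) v E \<subseteq> carrier (rng Quot I)"
      using Suc_dim by (auto simp: Q.line_extension_mem_iff subset_iff)
    ultimately show ?case by simp
  qed
  from this[OF dim, THEN conjunct2] have "P.dimension n (scalars ?F) {coset ?F p | p. coset I (h p) \<in> carrier (rng Quot I)}" .
  moreover have "{coset ?F p | p. coset I (h p) \<in> carrier (rng Quot I)} = carrier (rng Quot ?F)"
    by (auto simp: carrier_Quot I F)
  ultimately show ?thesis by simp
qed

section \<open>Homomorphisms into a quotient\<close>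

abbreviation quot_homs :: "'a::comm_ring_1 set \<Rightarrow> 'a set \<Rightarrow> ('a \<Rightarrow> 'a set) set"
  where "quot_homs I J \<equiv> module_hom_set rng (ideal_module I) (quot_module (\<lambda>r. r) J)"

text \<open>
  A homomorphism \<open>\<phi> : I \<rightarrow> A/J\<close> as a multivalued map \<open>I \<rightarrow> A\<close>: the set \<open>\<phi> p\<close> consists of the representatives of
  the value at \<open>p\<close>. Linearity then becomes a statement about membership, which is how the ideals \<open>deformation\<close>
  below refer to \<open>\<phi>\<close>.
\<close>

lemma quot_homs_iff:
  fixes I J :: "'a::comm_ring_1 set"
  assumes I: "ideal I rng" and J: "ideal J rng"
  shows "\<phi> \<in> quot_homs I J \<longleftrightarrow> \<phi> \<in> extensional I \<and> (\<forall>p\<in>I. \<exists>e. \<phi> p = coset J e) \<and>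
    (\<forall>p\<in>I. \<forall>q\<in>I. \<forall>e\<in>\<phi> p. \<forall>e'\<in>\<phi> q. e + e' \<in> \<phi> (p + q)) \<and>
    (\<forall>p\<in>I. \<forall>e\<in>\<phi> p. \<forall>r. r * e \<in> \<phi> (r * p))" (is "_ \<longleftrightarrow> ?R")
proof
  assume "\<phi> \<in> quot_homs I J"
  then have ext: "\<phi> \<in> extensional I" and car: "\<And>p. p \<in> I \<Longrightarrow> \<exists>e. \<phi> p = coset J e"
    and add: "\<And>p q. p \<in> I \<Longrightarrow> q \<in> I \<Longrightarrow> \<phi> (p + q) = \<phi> p \<oplus>\<^bsub>quot_module (\<lambda>r. r) J\<^esub> \<phi> q"
    and smult: "\<And>r p. p \<in> I \<Longrightarrow> \<phi> (r * p) = r \<odot>\<^bsub>quot_module (\<lambda>r. r) J\<^esub> \<phi> p"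
    by (auto simp: module_hom_set_def quot_module_simps[OF J] PiE_def Pi_def image_iff)
  have rep: "\<phi> p = coset J e" if "p \<in> I" "e \<in> \<phi> p" for p e
    using car[OF that(1)] that(2) coset_eqI[OF J] by blast
  have "e + e' \<in> \<phi> (p + q)" if "p \<in> I" "q \<in> I" "e \<in> \<phi> p" "e' \<in> \<phi> q" for p q e e'
    using rep[OF that(1,3)] rep[OF that(2,4)] that
    by (simp add: add quot_module_simps[OF J] mem_coset_self[OF J])
  moreover have "r * e \<in> \<phi> (r * p)" if "p \<in> I" "e \<in> \<phi> p" for p e r
    using rep[OF that] that by (simp add: smult quot_module_simps[OF J] mem_coset_self[OF J])
  ultimately show ?R using ext car by blast
next
  assume R: ?R
  have rep: "\<phi> p = coset J e" if "p \<in> I" "e \<in> \<phi> p" for p e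
  proof -
    obtain e' where "\<phi> p = coset J e'" using R \<open>p \<in> I\<close> by blast
    then show ?thesis using that(2) coset_eqI[OF J] by blast
  qed
  have ex: "\<exists>e. e \<in> \<phi> p" if "p \<in> I" for p
    using R that mem_coset_self[OF J] by blast
  have "\<phi> (p + q) = \<phi> p \<oplus>\<^bsub>quot_module (\<lambda>r. r) J\<^esub> \<phi> q" if pq: "p \<in> I" "q \<in> I" for p q
  proof -
    obtain e e' where e: "e \<in> \<phi> p" "e' \<in> \<phi> q" using ex pq by blast
    then have "e + e' \<in> \<phi> (p + q)" using R pq by blast
    then show ?thesis
      using rep[OF pq(1) e(1)] rep[OF pq(2) e(2)] rep[OF ideal_add[OF I pq]]
      by (simp add: quot_module_simps[OF J])
  qed
  moreover have "\<phi> (r * p) = r \<odot>\<^bsub>quot_module (\<lambda>r. r) J\<^esub> \<phi> p" if p: "p \<in> I" for r p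
  proof -
    obtain e where e: "e \<in> \<phi> p" using ex p by blast
    then have "r * e \<in> \<phi> (r * p)" using R p by blast
    then show ?thesis
      using rep[OF p e] rep[OF ideal_mult[OF I p]] by (simp add: quot_module_simps[OF J])
  qed
  ultimately show "\<phi> \<in> quot_homs I J"
    using R unfolding module_hom_set_def by (auto simp: quot_module_simps[OF J] image_iff PiE_def)
qed

lemma
  fixes I J :: "'a::comm_ring_1 set"
  assumes I: "ideal I rng" and J: "ideal J rng" and \<phi>: "\<phi> \<in> quot_homs I J" and p: "p \<in> I"
  shows quot_hom_ex: "\<exists>e. e \<in> \<phi> p"
    and quot_hom_add: "q \<in> I \<Longrightarrow> e \<in> \<phi> p \<Longrightarrow> e' \<in> \<phi> q \<Longrightarrow> e + e' \<in> \<phi> (p + q)"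
    and quot_hom_mult: "e \<in> \<phi> p \<Longrightarrow> r * e \<in> \<phi> (r * p)"
    and quot_hom_coset: "e \<in> \<phi> p \<Longrightarrow> \<phi> p = coset J e"
    and quot_hom_mem_iff: "e \<in> \<phi> p \<Longrightarrow> e' \<in> \<phi> p \<longleftrightarrow> e' - e \<in> J"
proof -
  note R = \<phi>[unfolded quot_homs_iff[OF I J]]
  show "\<exists>e. e \<in> \<phi> p" using R p mem_coset_self[OF J] by blast
  show "q \<in> I \<Longrightarrow> e \<in> \<phi> p \<Longrightarrow> e' \<in> \<phi> q \<Longrightarrow> e + e' \<in> \<phi> (p + q)" "e \<in> \<phi> p \<Longrightarrow> r * e \<in> \<phi> (r * p)"
    using R p by blast+
  obtain e0 where "\<phi> p = coset J e0" using R p by blast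
  then show *: "\<phi> p = coset J e" if "e \<in> \<phi> p" 
    using that coset_eqI[OF J] by blast
  show "e \<in> \<phi> p \<Longrightarrow> e' \<in> \<phi> p \<longleftrightarrow> e' - e \<in> J"
    using * by (simp add: mem_coset_iff[OF J])
qed

lemma quot_hom_0:
  fixes I J :: "'a::comm_ring_1 set"
  assumes I: "ideal I rng" and J: "ideal J rng" and \<phi>: "\<phi> \<in> quot_homs I J"
  shows "\<phi> 0 = J"
proof -
  obtain e where "e \<in> \<phi> 0" using quot_hom_ex[OF I J \<phi> ideal_0[OF I]] by blast
  from quot_hom_mult[OF I J \<phi> ideal_0[OF I] this, of 0] have "0 \<in> \<phi> 0" by simp
  then show ?thesis using quot_hom_coset[OF I J \<phi> ideal_0[OF I]] coset_0[OF J] by simp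
qed

section \<open>Polynomials over the dual numbers\<close>

lemma dual_eq_iff: "a = b \<longleftrightarrow> dval a = dval b \<and> (\<forall>k. deps a k = deps b k)"
  by (cases a; cases b) auto

lemma dual_simps [simp]:
  "dval 0 = 0" "dval 1 = 1" "dval (a + b) = dval a + dval b" "dval (a - b) = dval a - dval b"
  "dval (- a) = - dval a" "dval (a * b) = dval a * dval b"
  "deps 0 k = 0" "deps 1 k = 0" "deps (a + b) k = deps a k + deps b k" "deps (a - b) k = deps a k - deps b k"
  "deps (- a) k = - deps a k" "deps (a * b) k = dval a * deps b k + deps a k * dval b"
  by (simp_all add: zero_dual_def one_dual_def plus_dual_def minus_dual_def uminus_dual_def times_dual_def)

abbreviation map_poly2 :: "('a::zero \<Rightarrow> 'b::zero) \<Rightarrow> 'a poly poly \<Rightarrow> 'b poly poly"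
  where "map_poly2 h \<equiv> map_poly (map_poly h)"

lemma coeff_map_poly2: "h 0 = 0 \<Longrightarrow> coeff (coeff (map_poly2 h f) i) j = h (coeff (coeff f i) j)"
  by (simp add: coeff_map_poly)

lemma map_poly_additive:
  assumes "\<And>a b. h (a + b) = h a + (h b :: 'b::comm_ring_1)"
  shows "map_poly h (p + q) = map_poly h p + map_poly h (q :: 'a::comm_ring_1 poly)"
proof -
  have "h 0 = 0" using assms[of 0 0] by simp
  then show ?thesis by (intro poly_eqI) (simp add: coeff_map_poly assms)
qed

lemma sum_of_additive:
  assumes "\<And>a b. h (a + b) = h a + (h b :: 'b::ab_group_add)"
  shows "h (\<Sum>x\<in>A. f x) = (\<Sum>x\<in>A. h (f x :: 'a::ab_group_add))"
proof -
  have "h 0 = 0" using assms[of 0 0] by simp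
  then show ?thesis by (induction A rule: infinite_finite_induct) (simp_all add: assms)
qed

text \<open>
  If \<open>d\<close> is a derivation along \<open>h\<close>, then so is its action on coefficients. This is applied twice, to
  pass from the dual numbers to polynomials in two variables over them.
\<close>

lemma map_poly_derivation:
  fixes h d :: "'a::comm_ring_1 \<Rightarrow> 'b::comm_ring_1"
  assumes h: "\<And>a b. h (a + b) = h a + h b" and d: "\<And>a b. d (a + b) = d a + d b"
    and mult: "\<And>a b. d (a * b) = h a * d b + d a * h b"
  shows "map_poly d (p * q) = map_poly h p * map_poly d q + map_poly d p * map_poly h q"
proof -
  have "h 0 = 0" "d 0 = 0" using h[of 0 0] d[of 0 0] by simp_all
  then show ?thesis
    by (intro poly_eqI) (simp add: coeff_map_poly coeff_mult sum_of_additive[of d, OF d] mult sum.distrib)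
qed

lemma map_poly_multiplicative:
  fixes h :: "'a::comm_ring_1 \<Rightarrow> 'b::comm_ring_1"
  assumes h: "\<And>a b. h (a + b) = h a + h b" and mult: "\<And>a b. h (a * b) = h a * h b"
  shows "map_poly h (p * q) = map_poly h p * map_poly h q"
proof -
  have "h 0 = 0" using h[of 0 0] by simp
  then show ?thesis
    by (intro poly_eqI) (simp add: coeff_map_poly coeff_mult sum_of_additive[of h, OF h] mult)
qed

lemma
  fixes h :: "'a::comm_ring_1 \<Rightarrow> 'b::comm_ring_1"
  assumes h: "\<And>a b. h (a + b) = h a + h b"
  shows map_poly2_add: "map_poly2 h (f + g) = map_poly2 h f + map_poly2 h g"
    and map_poly2_const: "map_poly2 h (const2 a) = const2 (h a)"
    and map_poly2_mult: "(\<And>a b. h (a * b) = h a * h b) \<Longrightarrow> map_poly2 h (f * g) = map_poly2 h f * map_poly2 h g"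
proof -
  have "h 0 = 0" using h[of 0 0] by simp
  then show "map_poly2 h (const2 a) = const2 (h a)"
    by (simp add: map_poly_pCons)
qed (intro map_poly_additive map_poly_multiplicative h; assumption)+

lemma map_poly2_id: "h 0 = 0 \<Longrightarrow> (\<And>a. h (g a) = a) \<Longrightarrow> g 0 = 0 \<Longrightarrow> map_poly2 h (map_poly2 g f) = f"
  by (intro poly_eqI) (simp add: coeff_map_poly2)

text \<open>
  The components of a polynomial over the dual numbers: \<open>f = emb (val f) + \<Sum>\<^sub>k \<epsilon>\<^sub>k emb (eps k f)\<close>. The map \<open>val\<close> is
  a ring homomorphism, and each \<open>eps k\<close> is a derivation along it.
\<close>

abbreviation val :: "'k dual poly poly \<Rightarrow> complex poly poly"
  where "val \<equiv> map_poly2 dval"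

abbreviation eps :: "'k \<Rightarrow> 'k dual poly poly \<Rightarrow> complex poly poly"
  where "eps k \<equiv> map_poly2 (\<lambda>a. deps a k)"

abbreviation emb :: "complex poly poly \<Rightarrow> 'k dual poly poly"
  where "emb \<equiv> map_poly2 dual_of_complex"

definition eps_elt :: "'k \<Rightarrow> 'k dual"
  where "eps_elt k = Dual 0 (\<lambda>l. of_bool (l = k))"

lemma eps_elt_simps [simp]: "dval (eps_elt k) = 0" "deps (eps_elt k) l = of_bool (l = k)"
  by (simp_all add: eps_elt_def)

lemma dual_of_complex_simps [simp]: "dval (dual_of_complex c) = c" "deps (dual_of_complex c) l = 0"
  by (simp_all add: dual_of_complex_def)

lemma dual_of_complex_hom:
  "dual_of_complex 0 = 0" "dual_of_complex (a + b) = dual_of_complex a + dual_of_complex b"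
  "dual_of_complex (a * b) = dual_of_complex a * dual_of_complex b"
  by (simp_all add: dual_eq_iff)

lemma poly_dual_eqI:
  assumes "val f = val g" and "\<And>k. eps k f = eps k g"
  shows "f = g"
proof (intro poly_eqI)
  fix i j
  have "dval (coeff (coeff f i) j) = dval (coeff (coeff g i) j)"
    using arg_cong[OF assms(1), of "\<lambda>p. coeff (coeff p i) j"] by (simp add: coeff_map_poly2)
  moreover have "deps (coeff (coeff f i) j) k = deps (coeff (coeff g i) j) k" for k
    using arg_cong[OF assms(2)[of k], of "\<lambda>p. coeff (coeff p i) j"] by (simp add: coeff_map_poly2)
  ultimately show "coeff (coeff f i) j = coeff (coeff g i) j" by (simp add: dual_eq_iff)
qed

lemma val_eps_simps [simp]:
  "val (f + g) = val f + val g" "val (f - g) = val f - val g" "val (f * g) = val f * val g"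
  "val (const2 a) = const2 (dval a)" "val (emb p) = p"
  "eps k (f + g) = eps k f + eps k g" "eps k (f - g) = eps k f - eps k g"
  "eps k (f * g) = val f * eps k g + eps k f * val g"
  "eps k (const2 a) = const2 (deps a k)" "eps k (emb p) = 0"
proof -
  show add: "val (f + g) = val f + val g" "eps k (f + g) = eps k f + eps k g" for f g
    by (simp_all add: map_poly2_add)
  show "val (f - g) = val f - val g" "eps k (f - g) = eps k f - eps k g"
    using add[of "f - g" g] by simp_all
  show "val (f * g) = val f * val g" by (simp add: map_poly2_mult)
  show "val (const2 a) = const2 (dval a)" "eps k (const2 a) = const2 (deps a k)"
    by (simp_all add: map_poly2_const)
  show "val (emb p) = p" by (simp add: map_poly2_id dual_of_complex_hom)
  show "eps k (emb p) = 0"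
    by (intro poly_eqI) (simp add: coeff_map_poly2 dual_of_complex_hom)
  show "eps k (f * g) = val f * eps k g + eps k f * val g"
    by (intro map_poly_derivation map_poly_additive) simp_all
qed

lemma val_sum [simp]: "val (\<Sum>x\<in>A. f x) = (\<Sum>x\<in>A. val (f x))"
  by (rule sum_of_additive) simp

lemma eps_sum [simp]: "eps k (\<Sum>x\<in>A. f x) = (\<Sum>x\<in>A. eps k (f x))"
  by (rule sum_of_additive) simp

definition dual_poly :: "complex poly poly \<Rightarrow> ('k::finite \<Rightarrow> complex poly poly) \<Rightarrow> 'k dual poly poly"
  where "dual_poly v e = emb v + (\<Sum>k\<in>UNIV. const2 (eps_elt k) * emb (e k))"

lemma dual_poly_simps [simp]: "val (dual_poly v e) = v" "eps k (dual_poly v e) = e k"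
proof -
  show "val (dual_poly v e) = v" by (simp add: dual_poly_def)
  have "const2 (of_bool P) * q = (if P then q else 0)" for P and q :: "complex poly poly"
    by (simp add: one_pCons[symmetric])
  then have "eps k (dual_poly v e) = (\<Sum>l\<in>UNIV. if k = l then e l else 0)"
    by (simp add: dual_poly_def)
  then show "eps k (dual_poly v e) = e k" by simp
qed

lemma val_eq_0_decomp:
  fixes f :: "'k::finite dual poly poly"
  assumes "val f = 0"
  shows "f = (\<Sum>k\<in>UNIV. const2 (eps_elt k) * emb (eps k f))"
proof -
  have "f = dual_poly 0 (\<lambda>k. eps k f)" by (rule poly_dual_eqI) (simp_all add: assms)
  then show ?thesis by (simp add: dual_poly_def)
qed

lemma eps_elt_mult: "const2 (eps_elt k) * emb (val g) = const2 (eps_elt k) * g"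
  by (rule poly_dual_eqI) simp_all


section \<open>The ideals of flat families over the dual numbers\<close>

text \<open>
  The preimage, in the polynomials over the dual numbers, of the graph of the family \<open>\<phi>\<^sub>k : I \<rightarrow> R/I\<close>. If the
  \<open>\<phi>\<^sub>k\<close> are linear, this is the ideal of the first-order deformation of \<open>V(I)\<close> with tangent directions \<open>\<phi>\<^sub>k\<close>.
\<close>

definition deformation ::
    "complex poly poly set \<Rightarrow> ('k \<Rightarrow> complex poly poly \<Rightarrow> complex poly poly set) \<Rightarrow> 'k dual poly poly set"
  where "deformation I \<phi> = {f. val f \<in> I \<and> (\<forall>k. eps k f \<in> \<phi> k (val f))}"

text \<open>
  For \<open>r = a + \<Sum> b\<^sub>k \<epsilon>\<^sub>k\<close>, the \<open>\<epsilon>\<^sub>k\<close>-part of \<open>r (f + \<Sum> e\<^sub>k \<epsilon>\<^sub>k)\<close> is \<open>a e\<^sub>k + b\<^sub>k f\<close>. Modulo \<open>I\<close> the second term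
  vanishes, and the first represents \<open>\<phi>\<^sub>k(a f)\<close> by linearity.
\<close>

lemma ideal_deformation:
  assumes I: "ideal I rng" and \<phi>: "\<And>k. \<phi> k \<in> quot_homs I I"
  shows "ideal (deformation I \<phi>) rng"
  unfolding ideal_rng_iff
proof (intro conjI ballI allI)
  show "0 \<in> deformation I \<phi>"
    by (simp add: deformation_def ideal_0[OF I] quot_hom_0[OF I I \<phi>])
  show "f + g \<in> deformation I \<phi>" if "f \<in> deformation I \<phi>" "g \<in> deformation I \<phi>" for f g
    using that by (auto simp: deformation_def ideal_add[OF I] intro!: quot_hom_add[OF I I \<phi>])
  show "r * f \<in> deformation I \<phi>" if "f \<in> deformation I \<phi>" for r f
  proof -
    have f: "val f \<in> I" "\<And>k. eps k f \<in> \<phi> k (val f)" using that by (auto simp: deformation_def)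
    have rf: "val r * val f \<in> I" using ideal_mult[OF I f(1)] .
    have "val r * eps k f + eps k r * val f \<in> \<phi> k (val r * val f)" for k
      unfolding quot_hom_mem_iff[OF I I \<phi> rf quot_hom_mult[OF I I \<phi> f(1) f(2)]]
      using ideal_mult[OF I f(1)] by simp
    then show ?thesis using rf by (simp add: deformation_def)
  qed
qed

lemma deformation_lift:
  fixes \<phi> :: "'k::finite \<Rightarrow> complex poly poly \<Rightarrow> complex poly poly set"
  assumes I: "ideal I rng" and \<phi>: "\<And>k. \<phi> k \<in> quot_homs I I" and p: "p \<in> I"
  shows "\<exists>f\<in>deformation I \<phi>. val f = p"
proof -
  from quot_hom_ex[OF I I \<phi> p] have "\<forall>k. \<exists>e. e \<in> \<phi> k p" by blast
  then obtain e where "\<And>k. e k \<in> \<phi> k p" by metis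
  then show ?thesis using p by (intro bexI[of _ "dual_poly p e"]) (auto simp: deformation_def)
qed

text \<open>
  The dual numbers form a local ring: \<open>a\<close> is invertible as soon as \<open>dval a \<noteq> 0\<close>.
\<close>

lemma maximalideal_dual:
  assumes "maximalideal \<mm> (rng :: 'k dual ring)"
  shows "\<mm> = {a. dval a = 0}"
proof -
  interpret maximalideal \<mm> "rng :: 'k dual ring" by (rule assms)
  have m: "ideal \<mm> rng" by (rule is_ideal)
  have M0: "ideal {a. dval a = 0} (rng :: 'k dual ring)" by (simp add: ideal_rng_iff)
  have "\<mm> \<subseteq> {a. dval a = 0}"
  proof (rule subsetI, rule ccontr)
    fix a assume a: "a \<in> \<mm>" "a \<notin> {a. dval a = 0}"
    (* The inverse of a + e is 1/a - e/a^2. *)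
    let ?b = "Dual (1 / dval a) (\<lambda>k. - deps a k / (dval a)\<^sup>2)"
    have "?b * a = 1" using a(2) by (simp add: dual_eq_iff power2_eq_square field_simps)
    then have "1 \<in> \<mm>" using ideal_mult[OF m a(1), of ?b] by simp
    then have "\<mm> = UNIV" using ideal_mult[OF m, of 1] by fastforce
    then show False using I_notcarr by simp
  qed
  then have "{a. dval a = 0} = \<mm> \<or> {a :: 'k dual. dval a = 0} = UNIV"
    using I_maximal[OF M0] by simp
  moreover have "(1 :: 'k dual) \<notin> {a. dval a = 0}" by simp
  ultimately show ?thesis by blast
qed

text \<open>
  A basis \<open>e\<^sub>i\<close> of \<open>R/I\<close> over \<open>\<complex>\<close> also generates the deformed quotient over the dual numbers, with linear
  coordinate functions, so that the quotient is projective. The coordinates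
  of \<open>f\<close> are found in two steps. The constant part is \<open>val f = \<Sum>\<^sub>i c\<^sub>i(val f) e\<^sub>i + q\<close> with \<open>q\<close> in \<open>I\<close>; subtracting
  a lift of \<open>q\<close> to the deformed ideal changes the \<open>\<epsilon>\<^sub>k\<close>-part by a representative \<open>t\<^sub>k(q)\<close> of \<open>\<phi>\<^sub>k(q)\<close>, and the
  coordinates of the remaining \<open>\<epsilon>\<^sub>k\<close>-part \<open>eps k f - t\<^sub>k(q)\<close> are the \<open>\<epsilon>\<^sub>k\<close>-parts of the coordinates of \<open>f\<close>. The choice
  of \<open>t\<^sub>k\<close> is irrelevant, because the \<open>c\<^sub>i\<close> vanish on \<open>I\<close>; this gives linearity. The closed fibre is \<open>R/I\<close>, of
  dimension \<open>n\<close>.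
\<close>

lemma finite_flat_deformation:
  fixes \<phi> :: "'k::finite \<Rightarrow> complex poly poly \<Rightarrow> complex poly poly set"
  assumes I: "ideal I rng" and \<phi>: "\<And>k. \<phi> k \<in> quot_homs I I" and n: "has_colength I n"
  shows "finite_flat_of_degree n (deformation I \<phi>)"
proof -
  note T = ideal_deformation[of I \<phi>, OF I \<phi>]
  obtain c e where "\<forall>i f g. c i (f + g) = c i f + c i g" "\<forall>i r f. c i (const2 r * f) = r * c i f"
    "\<forall>i. \<forall>f\<in>I. c i f = 0" "\<forall>f. f - (\<Sum>i<n. const2 (c i f) * e i) \<in> I"
    using colength_coordinates[OF I n] by (elim exE conjE)
  then have c_add: "\<And>i f g. c i (f + g) = c i f + c i g"
    and c_scale: "\<And>i r f. c i (const2 r * f) = r * c i f"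
    and c_I: "\<And>i f. f \<in> I \<Longrightarrow> c i f = 0"
    and basis: "\<And>f. f - (\<Sum>i<n. const2 (c i f) * e i) \<in> I" by blast+
  have c_diff: "c i (f - g) = c i f - c i g" for i f g
    using c_add[of i "f - g" g] by simp
  have c_eq: "c i f = c i g" if "f - g \<in> I" for i f g
    using c_I[OF that, of i] by (simp add: c_diff)
  define q where "q f = f - (\<Sum>i<n. const2 (c i f) * e i)" for f
  have qI: "q f \<in> I" for f unfolding q_def by (rule basis)
  have q_add: "q (f + g) = q f + q g" for f g
  proof -
    have "const2 (c i f + c i g) * e i = const2 (c i f) * e i + const2 (c i g) * e i" for i
      by (simp flip: distrib_right)
    then show ?thesis by (simp add: q_def c_add sum.distrib)
  qed
  have q_scale: "q (const2 r * f) = const2 r * q f" for r f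
  proof -
    have "const2 (r * c i f) * e i = const2 r * (const2 (c i f) * e i)" for i
      by (simp add: mult.assoc[symmetric] mult_pCons_left mult.commute[of r])
    then show ?thesis by (simp only: q_def c_scale right_diff_distrib sum_distrib_left)
  qed
  define t where "t k p = (SOME e. e \<in> \<phi> k p)" for k p
  have t: "t k p \<in> \<phi> k p" if "p \<in> I" for k p
    unfolding t_def by (rule someI_ex) (rule quot_hom_ex[OF I I \<phi> that])
  have t_eq: "c i (t k p) = c i e" if "p \<in> I" "e \<in> \<phi> k p" for i k p e
    by (rule c_eq) (use quot_hom_mem_iff[OF I I \<phi> that(1,2)] t[OF that(1)] in blast)
  define d where "d i f = Dual (c i (val f)) (\<lambda>k. c i (eps k f) - c i (t k (q (val f))))" for i f
  have d_add: "d i (f + g) = d i f + d i g" for i f g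
  proof -
    have "c i (t k (q (val f) + q (val g))) = c i (t k (q (val f))) + c i (t k (q (val g)))" for k
      unfolding c_add[symmetric]
      by (rule t_eq) (auto intro!: ideal_add[OF I] qI quot_hom_add[OF I I \<phi>] t)
    then show ?thesis by (simp add: d_def dual_eq_iff c_add q_add)
  qed
  have d_scale: "d i (const2 r * f) = r * d i f" for i r f
  proof -
    have "c i (t k (const2 (dval r) * q (val f))) = dval r * c i (t k (q (val f)))" for k
      unfolding c_scale[symmetric]
      by (rule t_eq) (auto intro!: ideal_mult[OF I] qI quot_hom_mult[OF I I \<phi>] t)
    then show ?thesis by (simp add: d_def dual_eq_iff c_add c_scale q_scale right_diff_distrib diff_add_eq)
  qed
  have d_T: "d i f = 0" if "f \<in> deformation I \<phi>" for i f
  proof -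
    have f: "val f \<in> I" "\<And>k. eps k f \<in> \<phi> k (val f)" using that by (auto simp: deformation_def)
    have "q (val f) = val f" by (simp add: q_def c_I[OF f(1)])
    then show ?thesis using t_eq[OF f(1) f(2)] by (simp add: d_def dual_eq_iff c_I[OF f(1)])
  qed
  have d_basis: "f - (\<Sum>i<n. const2 (d i f) * emb (e i)) \<in> deformation I \<phi>" for f
  proof -
    let ?g = "f - (\<Sum>i<n. const2 (d i f) * emb (e i))"
    have val: "val ?g = q (val f)" by (simp add: q_def d_def)
    have "eps k ?g \<in> \<phi> k (q (val f))" for k
    proof -
      have "c i (eps k f - t k (q (val f))) = deps (d i f) k" for i
        by (simp add: d_def c_diff)
      then have "eps k ?g - t k (q (val f)) \<in> I"
        using basis[of "eps k f - t k (q (val f))"] by (simp add: algebra_simps)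
      then show ?thesis using quot_hom_mem_iff[OF I I \<phi> qI t[OF qI]] by blast
    qed
    then show ?thesis unfolding deformation_def using val qI by simp
  qed
  have fibre: "genideal rng (deformation I \<phi> \<union> const2 ` \<mm>) = val -` I" if "maximalideal \<mm> (rng :: 'k dual ring)" for \<mm>
  proof
    have V: "ideal (val -` I) (rng :: 'k dual poly poly ring)"
      using I by (simp add: ideal_rng_iff)
    show "genideal rng (deformation I \<phi> \<union> const2 ` \<mm>) \<subseteq> val -` I"
      by (rule genideal_subset[OF V]) (auto simp: maximalideal_dual[OF that] deformation_def ideal_0[OF I])
    show "val -` I \<subseteq> genideal rng (deformation I \<phi> \<union> const2 ` \<mm>)" (is "_ \<subseteq> ?G")
    proof
      have G: "ideal ?G rng" by (rule ideal_genideal)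
      fix f :: "'k dual poly poly" assume "f \<in> val -` I"
      then obtain f0 where f0: "f0 \<in> deformation I \<phi>" "val f0 = val f"
        using deformation_lift[of I \<phi>, OF I \<phi>] by auto
      have "const2 (eps_elt k) \<in> ?G" for k
        by (rule subsetD[OF subset_genideal]) (simp add: maximalideal_dual[OF that])
      then have "f - f0 \<in> ?G"
        by (subst val_eq_0_decomp) (auto simp: f0 intro!: ideal_sum[OF G] ideal_mult2[OF G])
      moreover have "f0 \<in> ?G" using subset_genideal f0(1) by blast
      ultimately show "f \<in> ?G" using ideal_add[OF G] by fastforce
    qed
  qed
  have fibre_dimension: "ring.dimension (rng Quot (val -` I)) n (scalars (val -` I :: 'k dual poly poly set))
    (carrier (rng Quot (val -` I)))"
  proof (rule dimension_vimage[where g = dval])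
    show "surj (val :: 'k dual poly poly \<Rightarrow> _)" by (rule surjI[of _ emb]) simp
    show "surj (dval :: 'k dual \<Rightarrow> _)" by (rule surjI[of _ dual_of_complex]) simp
  qed (use I n in \<open>simp_all add: has_colength_def\<close>)
  show ?thesis
    unfolding finite_flat_of_degree_def Let_def
    by (intro conjI allI impI Span_of_generators[OF T d_basis])
      (simp_all only: fibre fibre_dimension flat_of_dual_basis[OF T d_add d_scale d_T d_basis])
qed

text \<open>
  The consequence of flatness that drives the classification: if \<open>\<Sum>\<^sub>k f\<^sub>k \<epsilon>\<^sub>k\<close> lies in \<open>I'\<close>, then each \<open>f\<^sub>k\<close> lies in
  the reduction \<open>I\<close> of \<open>I'\<close>. For \<open>\<Sum>\<^sub>k \<epsilon>\<^sub>k \<otimes> f\<^sub>k\<close> then vanishes in \<open>\<mm> \<otimes> B[x,y]/I'\<close>, where \<open>\<mm>\<close> is the maximal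
  ideal, and the balanced map \<open>\<mm> \<times> B[x,y]/I' \<rightarrow> R/I, (a, h) \<mapsto> deps a k \<cdot> val h\<close> extracts \<open>f\<^sub>k\<close>.
\<close>

lemma flat_eps_mem:
  fixes I' :: "'k::finite dual poly poly set"
  assumes I': "ideal I' rng" and flat: "flat_module (quot_module const2 I')"
    and f: "f \<in> I'" "val f = 0"
  shows "eps k f \<in> val ` I'"
proof -
  let ?\<aa> = "{a :: 'k dual. dval a = 0}" and ?I = "val ` I'"
  let ?g = "\<lambda>(a, u). const2 (deps a k) * val (SOME h. h \<in> u)"
  have \<aa>: "ideal ?\<aa> rng" by (simp add: ideal_rng_iff)
  have I: "ideal ?I rng"
    unfolding ideal_rng_iff
  proof (intro conjI ballI allI)
    show "0 \<in> ?I" using ideal_0[OF I'] by (force intro: image_eqI[of _ _ 0])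
    show "a + b \<in> ?I" if "a \<in> ?I" "b \<in> ?I" for a b
      using that by (auto simp flip: val_eps_simps(1) intro!: imageI ideal_add[OF I'])
    show "r * a \<in> ?I" if a: "a \<in> ?I" for r a
    proof -
      obtain f where "f \<in> I'" "a = val f" using a by blast
      then have "r * a = val (emb r * f)" "emb r * f \<in> I'" by (simp_all add: ideal_mult[OF I'])
      then show ?thesis by blast
    qed
  qed
  have rep: "val (SOME h. h \<in> coset I' f) - val f \<in> ?I" for f
    using rep_coset[OF I', of f] by (metis imageI val_eps_simps(2))
  have "(\<Sum>l\<in>UNIV. const2 (eps_elt l) * emb (eps l f)) \<in> I'"
    using f val_eq_0_decomp[OF f(2)] by simp
  from flat_relation[OF flat I' \<aa> _ this]
  have "(\<Sum>l\<in>UNIV. frag_of (eps_elt l, coset I' (emb (eps l f)))) \<in> ideal_tensor_null ?\<aa> I'"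
    by simp
  then have "frag_lin ?g (\<Sum>l\<in>UNIV. frag_of (eps_elt l, coset I' (emb (eps l f)))) \<in> ?I"
  proof (rule frag_lin_null[OF I' I _ _ _ \<aa>, rotated -1])
    fix a a' p assume "a \<in> ?\<aa>" "a' \<in> ?\<aa>"
    let ?r = "val (SOME h. h \<in> coset I' p)"
    have "const2 (deps a k + deps a' k) * ?r = const2 (deps a k) * ?r + const2 (deps a' k) * ?r"
      by (simp flip: distrib_right)
    then show "?g (a + a', coset I' p) - ?g (a, coset I' p) - ?g (a', coset I' p) \<in> ?I"
      by (simp add: ideal_0[OF I])
  next
    fix a p h assume "a \<in> ?\<aa>"
    let ?r = "\<lambda>p. val (SOME h. h \<in> coset I' p)"
    have "(?r (p + h) - val (p + h)) - (?r p - val p) - (?r h - val h) \<in> ?I"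
      by (intro ideal_diff[OF I] rep)
    then have "const2 (deps a k) * (?r (p + h) - ?r p - ?r h) \<in> ?I"
      by (intro ideal_mult[OF I]) (simp add: algebra_simps)
    then show "?g (a, coset I' (p + h)) - ?g (a, coset I' p) - ?g (a, coset I' h) \<in> ?I"
      by (simp add: right_diff_distrib)
  next
    fix a r p assume a: "a \<in> ?\<aa>"
    let ?r = "\<lambda>p. val (SOME h. h \<in> coset I' p)"
    have "const2 (dval r) * (?r p - val p) - (?r (const2 r * p) - val (const2 r * p)) \<in> ?I"
      by (intro ideal_diff[OF I] ideal_mult[OF I] rep)
    then have "const2 (deps a k) * (const2 (dval r) * ?r p - ?r (const2 r * p)) \<in> ?I"
      by (intro ideal_mult[OF I]) (simp add: algebra_simps)
    moreover have "const2 (deps (r * a) k) = const2 (deps a k) * const2 (dval r)"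
      using a by (simp add: mult_pCons_left)
    ultimately show "?g (r * a, coset I' p) - ?g (a, coset I' (const2 r * p)) \<in> ?I"
      by (simp only: prod.case right_diff_distrib mult.assoc)
  qed
  then have "(\<Sum>l\<in>UNIV. const2 (of_bool (k = l)) * val (SOME h. h \<in> coset I' (emb (eps l f)))) \<in> ?I"
    by (simp add: frag_lin_sum)
  moreover have "const2 (of_bool P) * q = (if P then q else 0)" for P and q :: "complex poly poly"
    by (simp add: one_pCons[symmetric])
  ultimately have "val (SOME h. h \<in> coset I' (emb (eps k f))) \<in> ?I"
    by simp
  then show ?thesis
    using ideal_diff[OF I _ rep[of "emb (eps k f)"]] by fastforce
qed

text \<open>
  The direction \<open>\<phi>\<^sub>k\<close> sends \<open>p\<close> to the \<open>\<epsilon>\<^sub>k\<close>-parts of all lifts of \<open>p\<close> to \<open>I'\<close>. Two lifts differ by an element of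
  \<open>I'\<close> with constant part zero, so by flatness their \<open>\<epsilon>\<^sub>k\<close>-parts differ by an element of \<open>I\<close>; conversely adding \<open>\<epsilon>\<^sub>k g\<close>
  with \<open>g\<close> in \<open>I'\<close> changes the \<open>\<epsilon>\<^sub>k\<close>-part by an arbitrary element of \<open>I\<close>.
\<close>

lemma flat_imp_deformation:
  fixes I' :: "'k::finite dual poly poly set"
  assumes I': "ideal I' rng" and flat: "flat_module (quot_module const2 I')"
    and I: "ideal I rng" and val: "val ` I' = I"
  shows "\<exists>\<phi>. (\<forall>k. \<phi> k \<in> quot_homs I I) \<and> I' = deformation I \<phi>"
proof -
  define \<phi> where "\<phi> k = (\<lambda>p\<in>I. {eps k f | f. f \<in> I' \<and> val f = p})" for k
  have mem: "e \<in> \<phi> k p \<longleftrightarrow> (\<exists>f\<in>I'. val f = p \<and> e = eps k f)" if "p \<in> I" for e k p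
    using that by (auto simp: \<phi>_def)
  have \<phi>_coset: "\<phi> k (val f) = coset I (eps k f)" if f: "f \<in> I'" for k f
  proof (intro Set.set_eqI iffI)
    have vf: "val f \<in> I" using val f by blast
    fix e assume "e \<in> \<phi> k (val f)"
    then obtain g where g: "g \<in> I'" "val g = val f" "e = eps k g" using mem[OF vf] by auto
    then have "eps k (g - f) \<in> val ` I'"
      by (intro flat_eps_mem[OF I' flat] ideal_diff[OF I'] f) simp_all
    then show "e \<in> coset I (eps k f)" by (simp add: mem_coset_iff[OF I] g val)
  next
    have vf: "val f \<in> I" using val f by blast
    fix e assume "e \<in> coset I (eps k f)"
    then obtain g where g: "g \<in> I'" "e - eps k f = val g" using val by (auto simp: mem_coset_iff[OF I])
    have "f + const2 (eps_elt k) * g \<in> I'" by (intro ideal_add[OF I'] ideal_mult[OF I'] f g)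
    moreover have "eps k (f + const2 (eps_elt k) * g) = e"
      using g(2) by (simp add: one_pCons[symmetric] algebra_simps)
    ultimately show "e \<in> \<phi> k (val f)" unfolding mem[OF vf]
      by (intro bexI[of _ "f + const2 (eps_elt k) * g"]) auto
  qed
  have hom: "\<phi> k \<in> quot_homs I I" for k
    unfolding quot_homs_iff[OF I I]
  proof (intro conjI ballI allI)
    show "\<phi> k \<in> extensional I" by (simp add: \<phi>_def)
    show "\<exists>e. \<phi> k p = coset I e" if "p \<in> I" for p
      using that \<phi>_coset val by blast
    show "e + e' \<in> \<phi> k (p + p')" if pp: "p \<in> I" "p' \<in> I" and e: "e \<in> \<phi> k p" "e' \<in> \<phi> k p'" for p p' e e'
    proof -
      obtain f f' where "f \<in> I'" "val f = p" "e = eps k f" "f' \<in> I'" "val f' = p'" "e' = eps k f'"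
        using e unfolding mem[OF pp(1)] mem[OF pp(2)] by blast
      then show ?thesis unfolding mem[OF ideal_add[OF I pp]]
        by (intro bexI[of _ "f + f'"]) (auto intro: ideal_add[OF I'])
    qed
    show "r * e \<in> \<phi> k (r * p)" if p: "p \<in> I" and e: "e \<in> \<phi> k p" for p e r
    proof -
      obtain f where "f \<in> I'" "val f = p" "e = eps k f" using e unfolding mem[OF p] by blast
      then show ?thesis unfolding mem[OF ideal_mult[OF I p]]
        by (intro bexI[of _ "emb r * f"]) (auto intro: ideal_mult[OF I'])
    qed
  qed
  have "I' = deformation I \<phi>"
  proof
    show "I' \<subseteq> deformation I \<phi>"
      using val by (auto simp: deformation_def \<phi>_coset mem_coset_self[OF I])
    show "deformation I \<phi> \<subseteq> I'"
    proof
      fix f assume "f \<in> deformation I \<phi>"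
      then have f: "val f \<in> I" "\<And>k. eps k f \<in> \<phi> k (val f)" by (auto simp: deformation_def)
      obtain g where g: "g \<in> I'" "val f = val g" using f(1) val by auto
      have "eps k f - eps k g \<in> I" for k
        using f(2)[of k] unfolding g(2) \<phi>_coset[OF g(1)] mem_coset_iff[OF I] .
      then have "\<exists>h\<in>I'. eps k (f - g) = val h" for k using val by auto
      then have "const2 (eps_elt k) * emb (eps k (f - g)) \<in> I'" for k
        using ideal_mult[OF I'] eps_elt_mult by metis
      then have "f - g \<in> I'"
        using val_eq_0_decomp[of "f - g"] g(2) ideal_sum[OF I'] by (metis (no_types, lifting) diff_self val_eps_simps(2))
      then show "f \<in> I'" using ideal_add[OF I' _ g(1)] by fastforce
    qed
  qed
  with hom show ?thesis by blast
qed

text \<open>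
  For surjective \<open>h\<close>, witnessed by a section \<open>s\<close>, the image of an ideal is an ideal, so nothing has to be generated.
\<close>

lemma base_change_surj:
  fixes h :: "'a::comm_ring_1 \<Rightarrow> 'b::comm_ring_1"
  assumes add: "\<And>a b. h (a + b) = h a + h b" and mult: "\<And>a b. h (a * b) = h a * h b"
    and s: "s 0 = 0" "\<And>a. h (s a) = a" and I: "ideal I rng"
  shows "base_change h I = map_poly2 h ` I" and "ideal (map_poly2 h ` I) rng"
proof -
  have h0: "h 0 = 0" using add[of 0 0] by simp
  show *: "ideal (map_poly2 h ` I) rng"
    unfolding ideal_rng_iff
  proof (intro conjI ballI allI)
    show "0 \<in> map_poly2 h ` I" using ideal_0[OF I] by (auto intro: image_eqI[of _ _ 0])
    show "a + b \<in> map_poly2 h ` I" if "a \<in> map_poly2 h ` I" "b \<in> map_poly2 h ` I" for a b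
      using that by (auto simp flip: map_poly2_add[OF add] intro!: imageI ideal_add[OF I])
    show "r * a \<in> map_poly2 h ` I" if a: "a \<in> map_poly2 h ` I" for r a
    proof -
      obtain f where "f \<in> I" "a = map_poly2 h f" using a by blast
      then have "r * a = map_poly2 h (map_poly2 s r * f)" "map_poly2 s r * f \<in> I"
        by (simp_all add: ideal_mult[OF I] map_poly2_mult[OF add mult] map_poly2_id[OF h0 s(2) s(1)])
      then show ?thesis by blast
    qed
  qed
  show "base_change h I = map_poly2 h ` I"
    unfolding base_change_def by (rule genideal_eq_self[OF *])
qed

text \<open>
  A base change to \<open>\<complex>[\<epsilon>]\<close> is determined by its inclusion in the deformation given by \<open>\<psi>\<close> and by its reduction being
  all of \<open>I\<close>: an element of the deformation differs from the image of a lift of its constant part by some \<open>\<epsilon> q\<close>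
  with \<open>q\<close> in \<open>I\<close>, and \<open>\<epsilon> q\<close> is \<open>\<epsilon>\<close> times the image of a lift of \<open>q\<close>. This argument covers
  homomorphisms \<open>h\<close> that are not surjective, such as \<open>\<complex> \<rightarrow> \<complex>[\<epsilon>]\<close> and \<open>\<epsilon> \<mapsto> 0\<close>.
\<close>

lemma base_change_eq_deformation:
  fixes h :: "'b::comm_ring_1 \<Rightarrow> unit dual"
  assumes add: "\<And>a b. h (a + b) = h a + h b" and mult: "\<And>a b. h (a * b) = h a * h b"
    and I: "ideal I rng" and \<psi>: "\<psi> \<in> quot_homs I I"
    and sub: "\<And>f. f \<in> I' \<Longrightarrow> val (map_poly2 h f) \<in> I \<and> eps () (map_poly2 h f) \<in> \<psi> (val (map_poly2 h f))"
    and surj: "\<And>p. p \<in> I \<Longrightarrow> \<exists>f\<in>I'. val (map_poly2 h f) = p"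
  shows "base_change h I' = deformation I (\<lambda>_. \<psi>)"
proof
  note T = ideal_deformation[of I "\<lambda>_::unit. \<psi>", OF I \<psi>]
  show "base_change h I' \<subseteq> deformation I (\<lambda>_. \<psi>)"
    unfolding base_change_def by (rule genideal_subset[OF T]) (use sub in \<open>auto simp: deformation_def\<close>)
  show "deformation I (\<lambda>_. \<psi>) \<subseteq> base_change h I'"
  proof
    have B: "ideal (base_change h I') rng" unfolding base_change_def by (rule ideal_genideal)
    have incl: "map_poly2 h f \<in> base_change h I'" if "f \<in> I'" for f
      using that subset_genideal[of "map_poly2 h ` I'"] unfolding base_change_def by blast
    fix g :: "unit dual poly poly" assume "g \<in> deformation I (\<lambda>_. \<psi>)"
    then have g: "val g \<in> I" "eps () g \<in> \<psi> (val g)" by (auto simp: deformation_def)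
    obtain f where f: "f \<in> I'" "val (map_poly2 h f) = val g" using surj[OF g(1)] by blast
    have "eps () (map_poly2 h f) \<in> \<psi> (val g)" using sub[OF f(1)] f(2) by simp
    from quot_hom_mem_iff[OF I I \<psi> g(1) this] g(2)
    have "eps () (g - map_poly2 h f) \<in> I" by simp
    then obtain f' where f': "f' \<in> I'" "val (map_poly2 h f') = eps () (g - map_poly2 h f)"
      using surj by blast
    have "g = map_poly2 h f + const2 (eps_elt ()) * map_poly2 h f'"
      by (rule poly_dual_eqI) (simp_all add: f f' one_pCons[symmetric])
    moreover have "map_poly2 h f + const2 (eps_elt ()) * map_poly2 h f' \<in> base_change h I'"
      by (intro ideal_add[OF B] ideal_mult[OF B] incl f f')
    ultimately show "g \<in> base_change h I'" by simp
  qed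
qed

section \<open>Module constructions\<close>

lemma module_ideal_module:
  assumes I: "ideal I (rng :: 'a::comm_ring_1 ring)"
  shows "Module.module rng (ideal_module I)"
proof (rule moduleI)
  show "abelian_group (ideal_module I)"
    by (rule abelian_groupI)
      (use ideal_uminus[OF I] in \<open>auto simp: ideal_0[OF I] ideal_add[OF I] algebra_simps intro: bexI[of _ "- _"]\<close>)
qed (auto simp: cring_rng ideal_mult[OF I] algebra_simps)

lemma module_quot_module:
  assumes I: "ideal I (rng :: 'a::comm_ring_1 ring)"
  shows "Module.module rng (quot_module (\<lambda>r. r) I)"
proof (rule moduleI)
  note q = quot_module_simps[OF I]
  have zero: "\<zero>\<^bsub>quot_module (\<lambda>r. r) I\<^esub> = coset I 0" by (simp add: q coset_0[OF I])
  show "abelian_group (quot_module (\<lambda>r. r) I)"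
  proof (rule abelian_groupI)
    fix x assume "x \<in> carrier (quot_module (\<lambda>r. r) I)"
    then obtain f where "x = coset I f" by (auto simp: q)
    then show "\<exists>y\<in>carrier (quot_module (\<lambda>r. r) I). y \<oplus>\<^bsub>quot_module (\<lambda>r. r) I\<^esub> x = \<zero>\<^bsub>quot_module (\<lambda>r. r) I\<^esub>"
      unfolding zero by (intro bexI[of _ "coset I (- f)"]) (auto simp: q)
  qed (unfold zero, auto simp: q algebra_simps)
qed (auto simp: cring_rng quot_module_simps[OF I] algebra_simps)

lemma Hom_module_simps:
  "carrier (Hom_module K M N) = module_hom_set K M N"
  "\<zero>\<^bsub>Hom_module K M N\<^esub> = (\<lambda>x\<in>carrier M. \<zero>\<^bsub>N\<^esub>)"
  "f \<oplus>\<^bsub>Hom_module K M N\<^esub> g = (\<lambda>x\<in>carrier M. f x \<oplus>\<^bsub>N\<^esub> g x)"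
  "r \<odot>\<^bsub>Hom_module K M N\<^esub> f = (\<lambda>x\<in>carrier M. r \<odot>\<^bsub>N\<^esub> f x)"
  by (simp_all add: Hom_module_def)

lemma module_Hom_module:
  assumes "Module.module K M" and "Module.module K N"
  shows "Module.module K (Hom_module K M N)"
proof -
  interpret M: Module.module K M by (rule assms)
  interpret N: Module.module K N by (rule assms)
  have car: "f x \<in> carrier N" if "f \<in> module_hom_set K M N" "x \<in> carrier M" for f x
    using that by (auto simp: module_hom_set_def)
  have ext: "f = g" if "f \<in> module_hom_set K M N" "g \<in> module_hom_set K M N" "\<And>x. x \<in> carrier M \<Longrightarrow> f x = g x" for f g
    using that by (auto simp: module_hom_set_def intro: PiE_ext)
  have zero: "(\<lambda>x\<in>carrier M. \<zero>\<^bsub>N\<^esub>) \<in> module_hom_set K M N"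
    by (auto simp: module_hom_set_def)
  have add: "(\<lambda>x\<in>carrier M. f x \<oplus>\<^bsub>N\<^esub> g x) \<in> module_hom_set K M N"
    if "f \<in> module_hom_set K M N" "g \<in> module_hom_set K M N" for f g
    using that by (auto simp: module_hom_set_def PiE_def Pi_def N.add.m_ac N.smult_r_distr)
  have smult: "(\<lambda>x\<in>carrier M. r \<odot>\<^bsub>N\<^esub> f x) \<in> module_hom_set K M N"
    if "f \<in> module_hom_set K M N" "r \<in> carrier K" for f r
    using that by (auto simp: module_hom_set_def PiE_def Pi_def N.smult_r_distr M.R.m_comm
        simp flip: N.smult_assoc1)
  show ?thesis
  proof (rule moduleI)
    show "cring K" by (rule M.R.cring_axioms)
    show "abelian_group (Hom_module K M N)"
    proof (rule abelian_groupI, unfold Hom_module_simps)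
      fix f assume f: "f \<in> module_hom_set K M N"
      let ?g = "\<lambda>x\<in>carrier M. (\<ominus>\<^bsub>K\<^esub> \<one>\<^bsub>K\<^esub>) \<odot>\<^bsub>N\<^esub> f x"
      have g: "?g \<in> module_hom_set K M N" by (rule smult) (simp_all add: f)
      have "(\<lambda>x\<in>carrier M. ?g x \<oplus>\<^bsub>N\<^esub> f x) = (\<lambda>x\<in>carrier M. \<zero>\<^bsub>N\<^esub>)"
        by (auto simp: N.smult_l_minus car[OF f] N.l_neg)
      then show "\<exists>g\<in>module_hom_set K M N. (\<lambda>x\<in>carrier M. g x \<oplus>\<^bsub>N\<^esub> f x) = (\<lambda>x\<in>carrier M. \<zero>\<^bsub>N\<^esub>)"
        using g by blast
    qed (auto intro!: zero add zero[unfolded restrict_def] add[unfolded restrict_def] ext simp: car N.add.m_ac)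
  qed (auto simp: Hom_module_simps car N.smult_r_distr N.smult_l_distr N.smult_assoc1 
      intro!: smult add smult[unfolded restrict_def] add[unfolded restrict_def] ext)
qed

lemma direct_sum_module_simps:
  "carrier (direct_sum_module M N) = carrier M \<times> carrier N"
  "\<zero>\<^bsub>direct_sum_module M N\<^esub> = (\<zero>\<^bsub>M\<^esub>, \<zero>\<^bsub>N\<^esub>)"
  "(x, y) \<oplus>\<^bsub>direct_sum_module M N\<^esub> (x', y') = (x \<oplus>\<^bsub>M\<^esub> x', y \<oplus>\<^bsub>N\<^esub> y')"
  "r \<odot>\<^bsub>direct_sum_module M N\<^esub> (x, y) = (r \<odot>\<^bsub>M\<^esub> x, r \<odot>\<^bsub>N\<^esub> y)"
  by (simp_all add: direct_sum_module_def)

lemma module_direct_sum_module: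
  assumes "Module.module K M" and "Module.module K N"
  shows "Module.module K (direct_sum_module M N)"
proof -
  interpret M: Module.module K M by (rule assms)
  interpret N: Module.module K N by (rule assms)
  show ?thesis
  proof (rule moduleI)
    show "cring K" by (rule M.R.cring_axioms)
    show "abelian_group (direct_sum_module M N)"
    proof (rule abelian_groupI)
      fix z assume "z \<in> carrier (direct_sum_module M N)"
      then obtain x y where "z = (x, y)" "x \<in> carrier M" "y \<in> carrier N"
        by (auto simp: direct_sum_module_simps)
      then show "\<exists>w\<in>carrier (direct_sum_module M N).
          w \<oplus>\<^bsub>direct_sum_module M N\<^esub> z = \<zero>\<^bsub>direct_sum_module M N\<^esub>"
        by (intro bexI[of _ "(\<ominus>\<^bsub>M\<^esub> x, \<ominus>\<^bsub>N\<^esub> y)"])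
          (auto simp: direct_sum_module_simps M.l_neg N.l_neg)
    qed (auto simp: direct_sum_module_simps M.add.m_ac N.add.m_ac)
  qed (auto simp: direct_sum_module_simps M.smult_r_distr M.smult_l_distr M.smult_assoc1
      N.smult_r_distr N.smult_l_distr N.smult_assoc1)
qed

lemma module_carrier_update:
  assumes "Module.module K M" and sub: "H \<subseteq> carrier M" and zero: "\<zero>\<^bsub>M\<^esub> \<in> H"
    and add: "\<And>x y. x \<in> H \<Longrightarrow> y \<in> H \<Longrightarrow> x \<oplus>\<^bsub>M\<^esub> y \<in> H"
    and smult: "\<And>r x. r \<in> carrier K \<Longrightarrow> x \<in> H \<Longrightarrow> r \<odot>\<^bsub>M\<^esub> x \<in> H"
  shows "Module.module K (M\<lparr>carrier := H\<rparr>)"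
proof -
  interpret M: Module.module K M by (rule assms)
  have "\<ominus>\<^bsub>M\<^esub> x \<in> H" if "x \<in> H" for x
  proof -
    have "\<ominus>\<^bsub>M\<^esub> x = (\<ominus>\<^bsub>K\<^esub> \<one>\<^bsub>K\<^esub>) \<odot>\<^bsub>M\<^esub> x"
      using sub that by (simp add: M.smult_l_minus subset_iff)
    then show ?thesis using smult[OF _ that] by simp
  qed
  with sub zero add smult have "submodule H K M" by (intro M.submoduleI) auto
  then show ?thesis by (rule submodule.submodule_is_module) (rule assms)
qed

lemma module_restrict_scalars:
  assumes "Module.module R M" and h: "h \<in> ring_hom K R" and K: "cring K"
  shows "Module.module K (restrict_scalars h M)"
proof -
  interpret M: Module.module R M by (rule assms)
  have "abelian_group (restrict_scalars h M)"
    by (rule abelian_groupI) (auto simp: restrict_scalars_def M.add.m_ac intro: M.l_neg bexI[of _ "\<ominus>\<^bsub>M\<^esub> _"])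
  then show ?thesis
    using ring_hom_closed[OF h] ring_hom_add[OF h] ring_hom_mult[OF h] ring_hom_one[OF h]
    by (intro moduleI K)
      (auto simp: restrict_scalars_def M.smult_r_distr M.smult_l_distr M.smult_assoc1)
qed

text \<open>
  Transport of structure: the module axioms of \<open>M\<close> are inherited from \<open>N\<close> along a compatible bijection. Here \<open>M\<close> will be
  the tangent space, whose addition is given by a description for which direct verification of the axioms
  would be cumbersome.
\<close>

lemma modules_isomorphic_transport:
  assumes "Module.module K N" and bij: "bij_betw g (carrier N) (carrier M)"
    and zero: "g \<zero>\<^bsub>N\<^esub> = \<zero>\<^bsub>M\<^esub>"
    and add: "\<And>x y. x \<in> carrier N \<Longrightarrow> y \<in> carrier N \<Longrightarrow> g (x \<oplus>\<^bsub>N\<^esub> y) = g x \<oplus>\<^bsub>M\<^esub> g y"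
    and smult: "\<And>r x. r \<in> carrier K \<Longrightarrow> x \<in> carrier N \<Longrightarrow> g (r \<odot>\<^bsub>N\<^esub> x) = r \<odot>\<^bsub>M\<^esub> g x"
  shows "modules_isomorphic K M N"
proof -
  interpret N: Module.module K N by (rule assms)
  have inj: "inj_on g (carrier N)" and img: "carrier M = g ` carrier N"
    using bij by (auto simp: bij_betw_def)
  have gM: "g x \<in> carrier M" if "x \<in> carrier N" for x using img that by blast
  have "abelian_group M"
  proof (rule abelian_groupI)
    fix y assume "y \<in> carrier M"
    then obtain x where "x \<in> carrier N" "y = g x" using img by blast
    then show "\<exists>z\<in>carrier M. z \<oplus>\<^bsub>M\<^esub> y = \<zero>\<^bsub>M\<^esub>"
      by (intro bexI[of _ "g (\<ominus>\<^bsub>N\<^esub> x)"]) (auto simp: gM N.l_neg zero simp flip: add)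
  qed (auto simp: img N.add.m_ac simp flip: add zero)
  then have M: "Module.module K M"
    by (intro moduleI N.R.cring_axioms)
      (auto simp: img N.smult_r_distr N.smult_l_distr N.smult_assoc1 simp flip: add smult)
  define f where "f = restrict (the_inv_into (carrier N) g) (carrier M)"
  have fg: "f (g x) = x" if "x \<in> carrier N" for x
    using that by (simp add: f_def gM the_inv_into_f_f[OF inj])
  have "f \<in> module_hom_set K M N"
    unfolding module_hom_set_def
  proof (intro CollectI conjI ballI)
    show "f \<in> carrier M \<rightarrow>\<^sub>E carrier N"
      unfolding img by (intro PiE_I) (auto simp: fg the_inv_into_f_f[OF inj] f_def[unfolded img])
  qed (auto simp: img fg simp flip: add smult)
  moreover have "bij_betw f (carrier M) (carrier N)"
    unfolding f_def using bij_betw_the_inv_into[OF bij] by (simp cong: bij_betw_cong)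
  ultimately show ?thesis
    using M assms(1) unfolding modules_isomorphic_def by blast
qed

section \<open>The kernel of delta\<close>

lemma Hom_to_quot_add_apply:
  assumes I: "ideal I rng" and J: "ideal J rng" and \<phi>: "\<phi> \<in> quot_homs I J" and \<psi>: "\<psi> \<in> quot_homs I J"
    and p: "p \<in> I" and e: "e \<in> \<phi> p" "e' \<in> \<psi> p"
  shows "(\<phi> \<oplus>\<^bsub>Hom_to_quot I J\<^esub> \<psi>) p = coset J (e + e')"
  using quot_hom_coset[OF I J \<phi> p e(1)] quot_hom_coset[OF I J \<psi> p e(2)] p
  by (simp add: Hom_module_simps quot_module_simps[OF J])

lemma Hom_to_quot_smult_apply:
  assumes I: "ideal I rng" and J: "ideal J rng" and \<phi>: "\<phi> \<in> quot_homs I J"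
    and p: "p \<in> I" and e: "e \<in> \<phi> p"
  shows "(r \<odot>\<^bsub>Hom_to_quot I J\<^esub> \<phi>) p = coset J (r * e)"
  using quot_hom_coset[OF I J \<phi> p e] p
  by (simp add: Hom_module_simps quot_module_simps[OF J])

lemma Hom_to_quot_zero_apply:
  assumes J: "ideal J (rng :: 'a::comm_ring_1 ring)" and p: "p \<in> I"
  shows "\<zero>\<^bsub>Hom_to_quot I J\<^esub> p = J"
  using p by (simp add: Hom_module_simps quot_module_simps[OF J])

lemma quot_proj_coset:
  assumes I: "ideal I (rng :: 'a::comm_ring_1 ring)" and J: "ideal J rng" and "I \<subseteq> J"
  shows "quot_proj J (coset I e) = coset J e"
proof (intro Set.set_eqI iffI)
  fix x assume "x \<in> quot_proj J (coset I e)"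
  then obtain j y where "j \<in> J" "y - e \<in> I" "x = j + y"
    by (auto simp: quot_proj_def set_add_def' mem_coset_iff[OF I])
  then show "x \<in> coset J e"
    using ideal_add[OF J, of j "y - e"] \<open>I \<subseteq> J\<close> by (auto simp: mem_coset_iff[OF J] algebra_simps)
next
  fix x assume "x \<in> coset J e"
  then have "x - e \<in> J" by (simp add: mem_coset_iff[OF J])
  then show "x \<in> quot_proj J (coset I e)"
    unfolding quot_proj_def set_add_def' by (intro UN_I[of "x - e"] UN_I[of e] mem_coset_self I) simp_all
qed

text \<open>
  At \<open>p\<close> in \<open>I\<close>, the condition \<open>\<pi>(\<alpha>(p)) = \<beta>(p)\<close> says that the coset \<open>\<alpha> p\<close> of \<open>I\<close> is contained in the coset \<open>\<beta> p\<close>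
  of \<open>J\<close>. In this form it is visibly the inclusion of the corresponding deformed ideals.
\<close>

lemma kernel_delta_iff:
  assumes I: "ideal I (rng :: 'a::comm_ring_1 ring)" and J: "ideal J rng" and IJ: "I \<subseteq> J"
  shows "(\<alpha>, \<beta>) \<in> a_kernel (direct_sum_module (Hom_to_quot I I) (Hom_to_quot J J)) (Hom_to_quot I J) (delta I J)
    \<longleftrightarrow> \<alpha> \<in> quot_homs I I \<and> \<beta> \<in> quot_homs J J \<and> (\<forall>p\<in>I. \<alpha> p \<subseteq> \<beta> p)"
proof -
  have "delta I J (\<alpha>, \<beta>) = \<zero>\<^bsub>Hom_to_quot I J\<^esub> \<longleftrightarrow> (\<forall>p\<in>I. \<alpha> p \<subseteq> \<beta> p)"
    if \<alpha>: "\<alpha> \<in> quot_homs I I" and \<beta>: "\<beta> \<in> quot_homs J J"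
  proof -
    have "quot_proj J (\<alpha> p) \<ominus>\<^bsub>rng Quot J\<^esub> \<beta> p = J \<longleftrightarrow> \<alpha> p \<subseteq> \<beta> p" if p: "p \<in> I" for p
    proof -
      have pJ: "p \<in> J" using p IJ by blast
      obtain e e' where "e \<in> \<alpha> p" "e' \<in> \<beta> p"
        using quot_hom_ex[OF I I \<alpha> p] quot_hom_ex[OF J J \<beta> pJ] by blast
      then have e: "\<alpha> p = coset I e" "\<beta> p = coset J e'"
        using quot_hom_coset[OF I I \<alpha> p] quot_hom_coset[OF J J \<beta> pJ] by blast+
      have "quot_proj J (\<alpha> p) \<ominus>\<^bsub>rng Quot J\<^esub> \<beta> p = J \<longleftrightarrow> e - e' \<in> J"
        unfolding e quot_proj_coset[OF I J IJ] minus_Quot[OF J]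
        using coset_eq_iff[OF J, of "e - e'" 0] by (simp add: coset_0[OF J])
      also have "\<dots> \<longleftrightarrow> \<alpha> p \<subseteq> \<beta> p"
      proof
        assume "e - e' \<in> J"
        then show "\<alpha> p \<subseteq> \<beta> p"
          using IJ ideal_add[OF J] unfolding e by (fastforce simp: mem_coset_iff I J)
      next
        assume "\<alpha> p \<subseteq> \<beta> p"
        then show "e - e' \<in> J" using mem_coset_self[OF I, of e] unfolding e by (auto simp: mem_coset_iff[OF J])
      qed
      finally show ?thesis .
    qed
    then show ?thesis
      by (auto simp: delta_def Hom_module_simps quot_module_simps[OF J] fun_eq_iff restrict_def)
  qed
  then show ?thesis
    by (auto simp: a_kernel_def' direct_sum_module_simps Hom_module_simps(1))
qed

abbreviation delta_kernel ::
    "complex poly poly set \<Rightarrow> complex poly poly set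
      \<Rightarrow> (complex, (complex poly poly \<Rightarrow> complex poly poly set) \<times> (complex poly poly \<Rightarrow> complex poly poly set)) module"
  where "delta_kernel I J \<equiv> restrict_scalars const2
      (kernel_module
        (direct_sum_module (Hom_to_quot I I) (Hom_to_quot J J))
        (Hom_to_quot I J)
        (delta I J))"

lemma delta_kernel_simps:
  assumes I: "ideal I rng" and J: "ideal J rng" and IJ: "I \<subseteq> J"
  shows "carrier (delta_kernel I J) =
      {(\<alpha>, \<beta>). \<alpha> \<in> quot_homs I I \<and> \<beta> \<in> quot_homs J J \<and> (\<forall>p\<in>I. \<alpha> p \<subseteq> \<beta> p)}"
    and "\<zero>\<^bsub>delta_kernel I J\<^esub> = (\<zero>\<^bsub>Hom_to_quot I I\<^esub>, \<zero>\<^bsub>Hom_to_quot J J\<^esub>)"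
    and "(\<alpha>, \<beta>) \<oplus>\<^bsub>delta_kernel I J\<^esub> (\<alpha>', \<beta>') =
      (\<alpha> \<oplus>\<^bsub>Hom_to_quot I I\<^esub> \<alpha>', \<beta> \<oplus>\<^bsub>Hom_to_quot J J\<^esub> \<beta>')"
    and "c \<odot>\<^bsub>delta_kernel I J\<^esub> (\<alpha>, \<beta>) =
      (const2 c \<odot>\<^bsub>Hom_to_quot I I\<^esub> \<alpha>, const2 c \<odot>\<^bsub>Hom_to_quot J J\<^esub> \<beta>)"
  using kernel_delta_iff[OF assms]
  by (auto simp: restrict_scalars_def kernel_module_def direct_sum_module_simps)

lemma module_delta_kernel:
  assumes I: "ideal I rng" and J: "ideal J rng" and IJ: "I \<subseteq> J"
  shows "Module.module rng (delta_kernel I J)"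
proof (rule module_restrict_scalars)
  show "const2 \<in> ring_hom (rng :: complex ring) rng"
    by (rule ring_hom_memI) (simp_all add: mult_pCons_left one_pCons)
  show "cring (rng :: complex ring)" by (rule cring_rng)
  let ?M = "direct_sum_module (Hom_to_quot I I) (Hom_to_quot J J)"
  note Hom = module_Hom_module[OF module_ideal_module module_quot_module]
  interpret HI: Module.module rng "Hom_to_quot I I" by (rule Hom[OF I I])
  interpret HJ: Module.module rng "Hom_to_quot J J" by (rule Hom[OF J J])
  note car = Hom_module_simps(1)
  show "Module.module rng (kernel_module ?M (Hom_to_quot I J) (delta I J))"
    unfolding kernel_module_def
  proof (rule module_carrier_update)
    show "Module.module rng ?M" by (intro module_direct_sum_module Hom I J)
    show "a_kernel ?M (Hom_to_quot I J) (delta I J) \<subseteq> carrier ?M" by (auto simp: a_kernel_def')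
    show "\<zero>\<^bsub>?M\<^esub> \<in> a_kernel ?M (Hom_to_quot I J) (delta I J)"
    proof -
      have "\<zero>\<^bsub>Hom_to_quot I I\<^esub> p \<subseteq> \<zero>\<^bsub>Hom_to_quot J J\<^esub> p" if "p \<in> I" for p
        using that IJ Hom_to_quot_zero_apply[OF J subsetD[OF IJ that]] by (simp add: Hom_to_quot_zero_apply[OF I])
      then show ?thesis
        unfolding direct_sum_module_simps kernel_delta_iff[OF assms]
        using HI.zero_closed HJ.zero_closed by (simp add: car)
    qed
  next
    fix x y assume "x \<in> a_kernel ?M (Hom_to_quot I J) (delta I J)" "y \<in> a_kernel ?M (Hom_to_quot I J) (delta I J)"
    then obtain \<alpha> \<beta> \<alpha>' \<beta>' where xy: "x = (\<alpha>, \<beta>)" "y = (\<alpha>', \<beta>')"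
      and \<alpha>: "\<alpha> \<in> quot_homs I I" "\<alpha>' \<in> quot_homs I I" and \<beta>: "\<beta> \<in> quot_homs J J" "\<beta>' \<in> quot_homs J J"
      and le: "\<And>p. p \<in> I \<Longrightarrow> \<alpha> p \<subseteq> \<beta> p" "\<And>p. p \<in> I \<Longrightarrow> \<alpha>' p \<subseteq> \<beta>' p"
      using kernel_delta_iff[OF assms] by (metis (no_types, lifting) surj_pair)
    have "(\<alpha> \<oplus>\<^bsub>Hom_to_quot I I\<^esub> \<alpha>') p \<subseteq> (\<beta> \<oplus>\<^bsub>Hom_to_quot J J\<^esub> \<beta>') p" if p: "p \<in> I" for p
    proof -
      obtain e e' where e: "e \<in> \<alpha> p" "e' \<in> \<alpha>' p" using quot_hom_ex[OF I I _ p] \<alpha> by metis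
      then have "e \<in> \<beta> p" "e' \<in> \<beta>' p" using le p by blast+
      then show ?thesis
        using Hom_to_quot_add_apply[OF I I \<alpha> p e] Hom_to_quot_add_apply[OF J J \<beta> subsetD[OF IJ p], of e e'] IJ
        by (auto simp: mem_coset_iff I J)
    qed
    then show "x \<oplus>\<^bsub>?M\<^esub> y \<in> a_kernel ?M (Hom_to_quot I J) (delta I J)"
      unfolding xy direct_sum_module_simps kernel_delta_iff[OF assms]
      using HI.a_closed HJ.a_closed \<alpha> \<beta> by (simp add: car)
  next
    fix r x assume "x \<in> a_kernel ?M (Hom_to_quot I J) (delta I J)"
    then obtain \<alpha> \<beta> where x: "x = (\<alpha>, \<beta>)"
      and \<alpha>: "\<alpha> \<in> quot_homs I I" and \<beta>: "\<beta> \<in> quot_homs J J" and le: "\<And>p. p \<in> I \<Longrightarrow> \<alpha> p \<subseteq> \<beta> p"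
      using kernel_delta_iff[OF assms] by (metis (no_types, lifting) surj_pair)
    have "(r \<odot>\<^bsub>Hom_to_quot I I\<^esub> \<alpha>) p \<subseteq> (r \<odot>\<^bsub>Hom_to_quot J J\<^esub> \<beta>) p" if p: "p \<in> I" for p
    proof -
      obtain e where e: "e \<in> \<alpha> p" using quot_hom_ex[OF I I \<alpha> p] by blast
      then have "e \<in> \<beta> p" using le p by blast
      then show ?thesis
        using Hom_to_quot_smult_apply[OF I I \<alpha> p e] Hom_to_quot_smult_apply[OF J J \<beta> subsetD[OF IJ p], of e] IJ
        by (auto simp: mem_coset_iff I J)
    qed
    then show "r \<odot>\<^bsub>?M\<^esub> x \<in> a_kernel ?M (Hom_to_quot I J) (delta I J)"
      unfolding x direct_sum_module_simps kernel_delta_iff[OF assms]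
      using HI.smult_closed HJ.smult_closed \<alpha> \<beta> by (simp add: car)
  qed
qed


section \<open>Tangent vectors\<close>

lemma map_poly2_comp:
  assumes "g 0 = 0" "h 0 = 0"
  shows "map_poly2 h (map_poly2 g f) = map_poly2 (\<lambda>a. h (g a)) f"
  by (intro poly_eqI) (simp add: coeff_map_poly2 assms)

lemma map_poly2_plus:
  assumes "g 0 = 0" "h 0 = 0"
  shows "map_poly2 (\<lambda>a. g a + h a) f = map_poly2 g f + (map_poly2 h f :: 'b::comm_ring_1 poly poly)"
  by (intro poly_eqI) (simp add: coeff_map_poly2 assms)

lemma map_poly2_scale:
  assumes "h 0 = 0"
  shows "map_poly2 (\<lambda>a. c * h a) f = const2 c * (map_poly2 h f :: 'b::comm_ring_1 poly poly)"
  by (intro poly_eqI) (simp add: coeff_map_poly2 assms mult_pCons_left)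

lemma dual_map_simps [simp]:
  "dval (dual_scale c a) = dval a" "deps (dual_scale c a) l = c * deps a l"
  "dval (dual_proj k b) = dval b" "deps (dual_proj k b) l = deps b k"
  "dval (dual_sum b) = dval b" "deps (dual_sum b) l = deps b False + deps b True"
  by (simp_all add: dual_scale_def dual_proj_def dual_sum_def)

lemma val_dual_maps [simp]:
  "val (map_poly2 (dual_scale c) f) = val f" "eps l (map_poly2 (dual_scale c) f) = const2 c * eps l f"
  "val (map_poly2 (dual_proj k) g) = val g" "eps l (map_poly2 (dual_proj k) g) = eps k g"
  "val (map_poly2 dual_sum g) = val g" "eps l (map_poly2 dual_sum g) = eps False g + eps True g"
  by (simp_all add: map_poly2_comp map_poly2_plus map_poly2_scale dual_eq_iff)

lemma base_change_dval:
  fixes I' :: "'k dual poly poly set"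
  assumes "ideal I' rng"
  shows "base_change dval I' = val ` I'"
  by (rule base_change_surj(1)[where s = dual_of_complex]) (simp_all add: assms dual_of_complex_hom)

lemma val_image_deformation:
  fixes \<phi> :: "'k::finite \<Rightarrow> complex poly poly \<Rightarrow> complex poly poly set"
  assumes "ideal I rng" and "\<And>k. \<phi> k \<in> quot_homs I I"
  shows "val ` deformation I \<phi> = I"
  using deformation_lift[of I \<phi>, OF assms] by (fastforce simp: deformation_def)

lemma base_change_dval_deformation:
  fixes \<phi> :: "'k::finite \<Rightarrow> complex poly poly \<Rightarrow> complex poly poly set"
  assumes "ideal I rng" and "\<And>k. \<phi> k \<in> quot_homs I I"
  shows "base_change dval (deformation I \<phi>) = I"
  using base_change_dval[OF ideal_deformation[of I \<phi>, OF assms]] val_image_deformation[of I \<phi>, OF assms] by simp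

text \<open>
  The two projections of a point over \<open>\<complex>[\<epsilon>\<^sub>1,\<epsilon>\<^sub>2]\<close> have the same reduction as the point itself; this puts any point that
  projects to given tangent vectors at \<open>(I, J)\<close> within reach of the classification.
\<close>

lemma base_change_dual_proj_dval:
  fixes I' :: "bool dual poly poly set"
  assumes I': "ideal I' rng"
  shows "base_change dval (base_change (dual_proj k) I') = base_change dval I'"
proof -
  let ?s = "\<lambda>a. Dual (dval a) (\<lambda>_. deps a ()) :: bool dual"
  have "base_change (dual_proj k) I' = map_poly2 (dual_proj k) ` I'" "ideal (map_poly2 (dual_proj k) ` I') rng"
    by (rule base_change_surj[where s = ?s]; simp add: dual_eq_iff I')+
  then show ?thesis by (simp add: base_change_dval I' image_image)
qed

lemma base_change_dual_proj_deformation: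
  assumes I: "ideal I rng" and \<phi>: "\<And>k. \<phi> k \<in> quot_homs I I"
  shows "base_change (dual_proj k) (deformation I \<phi>) = deformation I (\<lambda>_. \<phi> k)"
  by (rule base_change_eq_deformation)
    (use deformation_lift[of I \<phi>, OF I \<phi>] in \<open>auto simp: dual_eq_iff I \<phi> deformation_def\<close>)

lemma base_change_dual_sum_deformation:
  assumes I: "ideal I rng" and \<phi>: "\<And>k. \<phi> k \<in> quot_homs I I"
  shows "base_change dual_sum (deformation I \<phi>) = deformation I (\<lambda>_. \<phi> False \<oplus>\<^bsub>Hom_to_quot I I\<^esub> \<phi> True)"
proof (rule base_change_eq_deformation)
  interpret H: Module.module rng "Hom_to_quot I I"
    by (rule module_Hom_module[OF module_ideal_module[OF I] module_quot_module[OF I]])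
  show "\<phi> False \<oplus>\<^bsub>Hom_to_quot I I\<^esub> \<phi> True \<in> quot_homs I I"
    using H.a_closed \<phi> by (simp add: Hom_module_simps(1))
  fix f assume "f \<in> deformation I \<phi>"
  then have f: "val f \<in> I" "\<And>k. eps k f \<in> \<phi> k (val f)" by (auto simp: deformation_def)
  show "val (map_poly2 dual_sum f) \<in> I \<and>
    eps () (map_poly2 dual_sum f) \<in> (\<phi> False \<oplus>\<^bsub>Hom_to_quot I I\<^esub> \<phi> True) (val (map_poly2 dual_sum f))"
    using Hom_to_quot_add_apply[OF I I \<phi> \<phi> f(1) f(2) f(2)] f(1) by (simp add: mem_coset_self[OF I])
qed (use deformation_lift[of I \<phi>, OF I \<phi>] I in \<open>simp_all add: dual_eq_iff algebra_simps\<close>)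

lemma base_change_dual_scale_deformation:
  assumes I: "ideal I rng" and \<alpha>: "\<alpha> \<in> quot_homs I I"
  shows "base_change (dual_scale c) (deformation I (\<lambda>_. \<alpha>)) = deformation I (\<lambda>_. const2 c \<odot>\<^bsub>Hom_to_quot I I\<^esub> \<alpha>)"
proof (rule base_change_eq_deformation)
  interpret H: Module.module rng "Hom_to_quot I I"
    by (rule module_Hom_module[OF module_ideal_module[OF I] module_quot_module[OF I]])
  show "const2 c \<odot>\<^bsub>Hom_to_quot I I\<^esub> \<alpha> \<in> quot_homs I I"
    using H.smult_closed \<alpha> by (simp add: Hom_module_simps(1))
  fix f :: "unit dual poly poly" assume "f \<in> deformation I (\<lambda>_. \<alpha>)"
  then have f: "val f \<in> I" "eps () f \<in> \<alpha> (val f)" by (auto simp: deformation_def)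
  show "val (map_poly2 (dual_scale c) f) \<in> I \<and>
    eps () (map_poly2 (dual_scale c) f) \<in> (const2 c \<odot>\<^bsub>Hom_to_quot I I\<^esub> \<alpha>) (val (map_poly2 (dual_scale c) f))"
    using Hom_to_quot_smult_apply[OF I I \<alpha> f] f(1) by (simp add: mem_coset_self[OF I])
qed (use deformation_lift[of I "\<lambda>_::unit. \<alpha>", OF I \<alpha>] I in \<open>simp_all add: dual_eq_iff algebra_simps\<close>)

lemma base_change_dual_of_complex:
  assumes I: "ideal I rng"
  shows "base_change (dual_of_complex :: complex \<Rightarrow> unit dual) I = deformation I (\<lambda>_. \<zero>\<^bsub>Hom_to_quot I I\<^esub>)"
proof (rule base_change_eq_deformation)
  interpret H: Module.module rng "Hom_to_quot I I"
    by (rule module_Hom_module[OF module_ideal_module[OF I] module_quot_module[OF I]])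
  show "\<zero>\<^bsub>Hom_to_quot I I\<^esub> \<in> quot_homs I I"
    using H.zero_closed by (simp add: Hom_module_simps(1))
qed (auto simp: I dual_of_complex_hom Hom_to_quot_zero_apply[OF I] ideal_0[OF I])

text \<open>
  A representative of \<open>\<alpha> p\<close> is read off from a lift of \<open>p\<close>.
\<close>

lemma deformation_unit_inj:
  assumes I: "ideal I rng" and \<alpha>: "\<alpha> \<in> quot_homs I I" and \<alpha>': "\<alpha>' \<in> quot_homs I I"
    and eq: "deformation I (\<lambda>_::unit. \<alpha>) = deformation I (\<lambda>_. \<alpha>')"
  shows "\<alpha> = \<alpha>'"
proof (rule extensionalityI)
  show "\<alpha> \<in> extensional I" "\<alpha>' \<in> extensional I"
    using \<alpha> \<alpha>' unfolding quot_homs_iff[OF I I] by blast+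
  fix p assume p: "p \<in> I"
  obtain e where e: "e \<in> \<alpha> p" using quot_hom_ex[OF I I \<alpha> p] by blast
  with p have "dual_poly p (\<lambda>_::unit. e) \<in> deformation I (\<lambda>_. \<alpha>)" by (simp add: deformation_def)
  then have "dual_poly p (\<lambda>_::unit. e) \<in> deformation I (\<lambda>_. \<alpha>')" by (simp only: eq)
  then have "e \<in> \<alpha>' p" by (simp add: deformation_def)
  then show "\<alpha> p = \<alpha>' p" using quot_hom_coset[OF I I \<alpha> p e] quot_hom_coset[OF I I \<alpha>' p] by blast
qed

text \<open>
  For the forward direction, a given representative \<open>e\<close> of \<open>\<phi>\<^sub>k(p)\<close> is completed to an element of the deformed ideal by
  arbitrary representatives \<open>t\<close> in the other directions.
\<close>

lemma deformation_subset_iff: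
  fixes \<phi> :: "'k::finite \<Rightarrow> complex poly poly \<Rightarrow> complex poly poly set"
  assumes I: "ideal I rng" and J: "ideal J rng" and IJ: "I \<subseteq> J"
    and \<phi>: "\<And>k. \<phi> k \<in> quot_homs I I" and \<psi>: "\<And>k. \<psi> k \<in> quot_homs J J"
  shows "deformation I \<phi> \<subseteq> deformation J \<psi> \<longleftrightarrow> (\<forall>k. \<forall>p\<in>I. \<phi> k p \<subseteq> \<psi> k p)"
proof
  assume sub: "deformation I \<phi> \<subseteq> deformation J \<psi>"
  show "\<forall>k. \<forall>p\<in>I. \<phi> k p \<subseteq> \<psi> k p"
  proof (intro allI ballI subsetI)
    fix k p e assume p: "p \<in> I" and e: "e \<in> \<phi> k p"
    from quot_hom_ex[OF I I \<phi> p] have "\<forall>l. \<exists>e. e \<in> \<phi> l p" by blast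
    then obtain t where "\<And>l. t l \<in> \<phi> l p" by metis
    with p e have "dual_poly p (t(k := e)) \<in> deformation I \<phi>" by (simp add: deformation_def)
    with sub have "dual_poly p (t(k := e)) \<in> deformation J \<psi>" by blast
    then have "eps k (dual_poly p (t(k := e))) \<in> \<psi> k (val (dual_poly p (t(k := e))))"
      unfolding deformation_def by blast
    then show "e \<in> \<psi> k p" by simp
  qed
qed (use IJ in \<open>fastforce simp: deformation_def\<close>)

lemma nested_hilb_deformation:
  fixes \<phi> \<psi> :: "'k::finite \<Rightarrow> complex poly poly \<Rightarrow> complex poly poly set"
  assumes I: "ideal I rng" and J: "ideal J rng" and IJ: "I \<subseteq> J"
    and n: "has_colength I (n + 1)" "has_colength J n"
    and \<phi>: "\<And>k. \<phi> k \<in> quot_homs I I" and \<psi>: "\<And>k. \<psi> k \<in> quot_homs J J"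
    and le: "\<And>k p. p \<in> I \<Longrightarrow> \<phi> k p \<subseteq> \<psi> k p"
  shows "(deformation I \<phi>, deformation J \<psi>) \<in> nested_hilb n"
  unfolding nested_hilb_def
  using ideal_deformation[of I \<phi>, OF I \<phi>] ideal_deformation[of J \<psi>, OF J \<psi>]
    deformation_subset_iff[of I J \<phi> \<psi>, OF I J IJ \<phi> \<psi>] le
    finite_flat_deformation[of I \<phi>, OF I \<phi> n(1)] finite_flat_deformation[of J \<psi>, OF J \<psi> n(2)]
  by simp

lemma nested_hilb_imp_deformation:
  fixes u :: "'k::finite dual poly poly set \<times> 'k dual poly poly set"
  assumes I: "ideal I rng" and J: "ideal J rng" and IJ: "I \<subseteq> J"
    and u: "u \<in> nested_hilb n" and pull: "pull dval u = (I, J)"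
  obtains \<phi> \<psi> where "u = (deformation I \<phi>, deformation J \<psi>)"
    and "\<And>k. \<phi> k \<in> quot_homs I I" and "\<And>k. \<psi> k \<in> quot_homs J J"
    and "\<And>k p. p \<in> I \<Longrightarrow> \<phi> k p \<subseteq> \<psi> k p"
proof -
  obtain I' J' where u': "u = (I', J')" by (cases u)
  have I': "ideal I' rng" "flat_module (quot_module const2 I')"
    and J': "ideal J' rng" "flat_module (quot_module const2 J')" and sub: "I' \<subseteq> J'"
    using u unfolding u' nested_hilb_def finite_flat_of_degree_def by auto
  have "val ` I' = I" "val ` J' = J"
    using pull base_change_dval[OF I'(1)] base_change_dval[OF J'(1)] by (auto simp: pull_def u')
  then obtain \<phi> \<psi> where \<phi>: "\<And>k. \<phi> k \<in> quot_homs I I" "I' = deformation I \<phi>"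
    and \<psi>: "\<And>k. \<psi> k \<in> quot_homs J J" "J' = deformation J \<psi>"
    using flat_imp_deformation[OF I' I] flat_imp_deformation[OF J' J] by metis
  show ?thesis
  proof (rule that)
    show "u = (deformation I \<phi>, deformation J \<psi>)" by (simp add: u' \<phi> \<psi>)
    show "\<phi> k p \<subseteq> \<psi> k p" if "p \<in> I" for k p
      using that sub deformation_subset_iff[of I J \<phi> \<psi>, OF I J IJ \<phi>(1) \<psi>(1)] \<phi>(2) \<psi>(2) by blast
  qed (rule \<phi> \<psi>)+
qed

theorem theorem6p1:
  fixes I J :: "complex poly poly set" and n :: nat
  assumes "ideal I rng" and "ideal J rng" and "I \<subseteq> J"
    and "has_colength I (n + 1)" and "has_colength J n"
  shows "modules_isomorphic (rng :: complex ring)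
    (tangent_space n (I, J))
    (restrict_scalars const2
      (kernel_module
        (direct_sum_module (Hom_to_quot I I) (Hom_to_quot J J))
        (Hom_to_quot I J)
        (delta I J)))"
proof (rule modules_isomorphic_transport)
  note IJ = assms(1-3) and n = assms(4,5)
  note I = assms(1) and J = assms(2)
  define g :: "_ \<Rightarrow> unit dual poly poly set \<times> unit dual poly poly set"
    where "g = (\<lambda>(\<alpha>, \<beta>). (deformation I (\<lambda>_. \<alpha>), deformation J (\<lambda>_. \<beta>)))"
  note simps = delta_kernel_simps[OF IJ]
  show "Module.module rng (delta_kernel I J)" by (rule module_delta_kernel[OF IJ])
  show "bij_betw g (carrier (delta_kernel I J)) (carrier (tangent_space n (I, J)))"
    unfolding bij_betw_def
  proof (intro conjI)
    show "inj_on g (carrier (delta_kernel I J))"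
      unfolding simps by (auto simp: inj_on_def g_def dest: deformation_unit_inj[OF I] deformation_unit_inj[OF J])
    show "g ` carrier (delta_kernel I J) = carrier (tangent_space n (I, J))"
    proof (intro subset_antisym subsetI)
      fix v assume "v \<in> g ` carrier (delta_kernel I J)"
      then obtain \<alpha> \<beta> where v: "v = (deformation I (\<lambda>_. \<alpha>), deformation J (\<lambda>_. \<beta>))"
        and \<alpha>: "\<alpha> \<in> quot_homs I I" and \<beta>: "\<beta> \<in> quot_homs J J" and le: "\<And>p. p \<in> I \<Longrightarrow> \<alpha> p \<subseteq> \<beta> p"
        unfolding simps by (auto simp: g_def)
      then show "v \<in> carrier (tangent_space n (I, J))"
        using nested_hilb_deformation[OF IJ n, of "\<lambda>_. \<alpha>" "\<lambda>_. \<beta>"]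
        by (simp add: tangent_space_def tangent_vectors_def pull_def base_change_dval_deformation I J)
    next
      fix v assume "v \<in> carrier (tangent_space n (I, J))"
      then have "v \<in> nested_hilb n" "pull dval v = (I, J)"
        by (simp_all add: tangent_space_def tangent_vectors_def)
      from nested_hilb_imp_deformation[OF IJ this] obtain \<phi> \<psi> where *: "v = (deformation I \<phi>, deformation J \<psi>)"
        "\<And>k. \<phi> k \<in> quot_homs I I" "\<And>k. \<psi> k \<in> quot_homs J J" "\<And>k p. p \<in> I \<Longrightarrow> \<phi> k p \<subseteq> \<psi> k p"
        by blast
      have "\<phi> = (\<lambda>_. \<phi> ())" "\<psi> = (\<lambda>_. \<psi> ())" by auto
      then have "v = g (\<phi> (), \<psi> ())" unfolding g_def using *(1) by simp
      moreover have "(\<phi> (), \<psi> ()) \<in> carrier (delta_kernel I J)" unfolding simps using * by blast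
      ultimately show "v \<in> g ` carrier (delta_kernel I J)" by blast
    qed
  qed
  show "g \<zero>\<^bsub>delta_kernel I J\<^esub> = \<zero>\<^bsub>tangent_space n (I, J)\<^esub>"
    by (simp add: simps g_def tangent_space_def pull_def base_change_dual_of_complex I J)
  fix x assume "x \<in> carrier (delta_kernel I J)"
  then obtain \<alpha> \<beta> where x: "x = (\<alpha>, \<beta>)"
    and \<alpha>: "\<alpha> \<in> quot_homs I I" and \<beta>: "\<beta> \<in> quot_homs J J" and le: "\<And>p. p \<in> I \<Longrightarrow> \<alpha> p \<subseteq> \<beta> p"
    unfolding simps by blast
  show "g (r \<odot>\<^bsub>delta_kernel I J\<^esub> x) = r \<odot>\<^bsub>tangent_space n (I, J)\<^esub> g x" for r
    by (simp add: x simps g_def tangent_space_def pull_def base_change_dual_scale_deformation I J \<alpha> \<beta>)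
  fix y assume "y \<in> carrier (delta_kernel I J)"
  then obtain \<alpha>' \<beta>' where y: "y = (\<alpha>', \<beta>')"
    and \<alpha>': "\<alpha>' \<in> quot_homs I I" and \<beta>': "\<beta>' \<in> quot_homs J J" and le': "\<And>p. p \<in> I \<Longrightarrow> \<alpha>' p \<subseteq> \<beta>' p"
    unfolding simps by blast
  (* The point over C[e1,e2] that defines the sum has direction alpha along e1 (index False) and
     alpha' along e2 (index True). *)
  define \<phi> where "\<phi> k = (if k then \<alpha>' else \<alpha>)" for k
  define \<psi> where "\<psi> k = (if k then \<beta>' else \<beta>)" for k
  have \<phi>: "\<phi> k \<in> quot_homs I I" and \<psi>: "\<psi> k \<in> quot_homs J J" and "p \<in> I \<Longrightarrow> \<phi> k p \<subseteq> \<psi> k p" for k p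
    using \<alpha> \<alpha>' \<beta> \<beta>' le le' by (simp_all add: \<phi>_def \<psi>_def)
  note proj = base_change_dual_proj_deformation
  have the: "(THE u. u \<in> nested_hilb n \<and> pull (dual_proj False) u = g x \<and> pull (dual_proj True) u = g y)
    = (deformation I \<phi>, deformation J \<psi>)"
  proof (rule the_equality, intro conjI)
    show "(deformation I \<phi>, deformation J \<psi>) \<in> nested_hilb n"
      by (rule nested_hilb_deformation[OF IJ n]) fact+
    show "pull (dual_proj False) (deformation I \<phi>, deformation J \<psi>) = g x" "pull (dual_proj True) (deformation I \<phi>, deformation J \<psi>) = g y"
      by (simp_all add: pull_def x y g_def proj[OF I \<phi>] proj[OF J \<psi>]) (simp_all add: \<phi>_def \<psi>_def)
    fix u assume u: "u \<in> nested_hilb n \<and> pull (dual_proj False) u = g x \<and> pull (dual_proj True) u = g y"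
    obtain I' J' where u': "u = (I', J')" by (cases u)
    have I': "ideal I' rng" "ideal J' rng" using u by (auto simp: nested_hilb_def u')
    (* Any other candidate u is a deformation of (I, J) as well, and its directions are read off
       from its projections. *)
    have "pull dval (pull (dual_proj False) u) = pull dval (g x)" using u by simp
    then have "pull dval u = (I, J)"
      using base_change_dual_proj_dval[OF I'(1)] base_change_dual_proj_dval[OF I'(2)]
      by (simp add: u' pull_def x g_def base_change_dval_deformation I J \<alpha> \<beta>)
    with u obtain \<phi>' \<psi>' where *: "u = (deformation I \<phi>', deformation J \<psi>')"
        "\<And>k. \<phi>' k \<in> quot_homs I I" "\<And>k. \<psi>' k \<in> quot_homs J J"
      using nested_hilb_imp_deformation[OF IJ] by metis
    have "\<phi>' k = \<phi> k" for k
      by (rule deformation_unit_inj[OF I *(2) \<phi>])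
        (use u in \<open>cases k; simp add: *(1) pull_def x y g_def proj[OF I *(2)] \<phi>_def\<close>)
    moreover have "\<psi>' k = \<psi> k" for k
      by (rule deformation_unit_inj[OF J *(3) \<psi>])
        (use u in \<open>cases k; simp add: *(1) pull_def x y g_def proj[OF J *(3)] \<psi>_def\<close>)
    ultimately have "\<phi>' = \<phi>" "\<psi>' = \<psi>" by blast+
    then show "u = (deformation I \<phi>, deformation J \<psi>)" by (simp add: *(1))
  qed
  have "g x \<oplus>\<^bsub>tangent_space n (I, J)\<^esub> g y = pull dual_sum (deformation I \<phi>, deformation J \<psi>)"
    by (simp add: tangent_space_def the)
  also have "\<dots> = g (x \<oplus>\<^bsub>delta_kernel I J\<^esub> y)"
    by (simp add: x y simps pull_def g_def base_change_dual_sum_deformation I J \<phi> \<psi>) (simp add: \<phi>_def \<psi>_def)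
  finally show "g (x \<oplus>\<^bsub>delta_kernel I J\<^esub> y) = g x \<oplus>\<^bsub>tangent_space n (I, J)\<^esub> g y" by simp
qed

end
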